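(* Let $H\in\mathbb{R}^{N\times N}$ be a real matrix and let $S_h\in\mathbb{C}^{N\times N}$ be a family of complex matrices depending smoothly on $h\in\mathbb{R}$ such that (i) $S_h$ is reversible: $S_h$ is invertible and $\overline{S}_h=S_h^{-1}$; (ii) $S_h$ is consistent with $\exp(ihH)$: there exists $p\ge 1$ such that $S_h = e^{ihH}+\mathcal{O}(h^{p+1})$ as $h\to 0$; (iii) the eigenvalues of $H$ are real and simple. Then there exist a family $D_h$ of real diagonal matrices depending smoothly on $h$ and a family $P_h$ of real invertible matrices depending smoothly on $h$ such that $P_h=P_0+\mathcal{O}(h^p)$, $D_h=D_0+\mathcal{O}(h^p)$ and, provided that $|h|$ is small enough, $$S_h = P_h\, e^{ihD_h}\, P_h^{-1}.$$
   Context: $\overline{S}_h$ denotes the entrywise complex conjugate (no transpose) of $S_h$. The exponent $p$ is an integer, and $\mathcal{O}(\cdot)$ is understood as $h\to 0$. *)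

theory Defs
  imports "HOL-Analysis.Analysis" "HOL-Computational_Algebra.Polynomial"
    "HOL-Library.Landau_Symbols"
begin

(* C-infinity on the whole real line: every iterated derivative exists everywhere. *)
definition smooth :: "(real \<Rightarrow> 'a::real_normed_vector) \<Rightarrow> bool" where
  "smooth f \<longleftrightarrow>
     (\<forall>k. ((\<lambda>g t. vector_derivative g (at t)) ^^ k) f differentiable_on UNIV)"

(* The class operations * and ^ on the type 'a^'n^'n are componentwise, so powers and
   the exponential of a matrix are defined from the matrix product **. *)
definition matrix_power :: "'a::semiring_1^'n^'n \<Rightarrow> nat \<Rightarrow> 'a^'n^'n" where
  "matrix_power A k = (((**) A) ^^ k) (mat 1)"

definition matrix_exp :: "complex^'n^'n \<Rightarrow> complex^'n^'n" where
  "matrix_exp A = (\<Sum>k. matrix_power A k /\<^sub>R fact k)"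

definition matrix_scale :: "'a::times \<Rightarrow> 'a^'n^'m \<Rightarrow> 'a^'n^'m" where
  "matrix_scale c A = map_matrix (\<lambda>a. c * a) A"

definition complexify :: "real^'n^'m \<Rightarrow> complex^'n^'m" where
  "complexify A = map_matrix complex_of_real A"

definition matrix_cnj :: "complex^'n^'m \<Rightarrow> complex^'n^'m" where
  "matrix_cnj A = map_matrix cnj A"

definition is_diagonal :: "'a::zero^'n^'n \<Rightarrow> bool" where
  "is_diagonal A \<longleftrightarrow> (\<forall>i j. i \<noteq> j \<longrightarrow> A $ i $ j = 0)"

definition reversible :: "complex^'n^'n \<Rightarrow> bool" where
  "reversible A \<longleftrightarrow> invertible A \<and> matrix_cnj A = matrix_inv A"

definition eigenvalue :: "'a::field^'n^'n \<Rightarrow> 'a \<Rightarrow> bool" where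
  "eigenvalue A c \<longleftrightarrow> (\<exists>v. v \<noteq> 0 \<and> A *v v = c *s v)"

(* det (X I - A), computed over the polynomial ring. *)
definition charpoly :: "'a::comm_ring_1^'n^'n \<Rightarrow> 'a poly" where
  "charpoly A = det (mat [:0, 1:] - map_matrix (\<lambda>a. [:a:]) A)"

(* A simple eigenvalue is one of algebraic multiplicity one. *)
definition simple_eigenvalue :: "'a::field^'n^'n \<Rightarrow> 'a \<Rightarrow> bool" where
  "simple_eigenvalue A c \<longleftrightarrow> eigenvalue A c \<and> order c (charpoly A) = 1"

end

theory Submission
  imports Defs "HOL-Computational_Algebra.Fundamental_Theorem_Algebra"
begin

text \<open>Diagonalise \<open>H = Q diag(\<nu>) Q\<^sup>-\<^sup>1\<close> over the reals and write \<open>Q\<^sup>-\<^sup>1 S Q = X + i Y\<close> with \<open>X\<close>, \<open>Y\<close> real.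
  Reversibility says exactly that \<open>X\<^sup>2 + Y\<^sup>2 = 1\<close> and \<open>X Y = Y X\<close>. Since \<open>Y\<close> vanishes at \<open>h = 0\<close>, the
  quotient \<open>C = Y / h\<close> extends smoothly, with \<open>C = diag(sin (h \<nu>) / h) + O(h\<^sup>p)\<close>. Its eigenvalues at
  \<open>h = 0\<close> are the simple reals \<open>\<nu>\<close>, so near the origin it has smooth eigenvalues \<open>\<mu>\<close>, by the implicit
  function theorem for the characteristic polynomial, and smooth eigenvectors given by cofactors; both
  are \<open>O(h\<^sup>p)\<close>-close to those of the diagonal part. As \<open>X\<close> commutes with \<open>C\<close>, the same basis
  diagonalises \<open>X\<close>, whose eigenvalues are the positive square roots of \<open>1 - (h \<mu>)\<^sup>2\<close>. Hence the
  eigenvalues of \<open>S\<close> are \<open>exp (i h d)\<close> with \<open>d = arcsin (h \<mu>) / h\<close>. Composition with a bounded smooth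
  function that is the identity near the origin makes all families global.\<close>

section \<open>Smooth functions of a real variable\<close>

text \<open>Level \<open>0\<close> carries no condition, not even continuity, which trivialises the base case of every
  induction on the level.\<close>

primrec ndiff :: "nat \<Rightarrow> (real \<Rightarrow> 'a::real_normed_vector) \<Rightarrow> bool" where
  "ndiff 0 f \<longleftrightarrow> True"
| "ndiff (Suc n) f \<longleftrightarrow> (\<exists>f'. (\<forall>x. (f has_vector_derivative f' x) (at x)) \<and> ndiff n f')"

lemma ndiff_SucI:
  "(\<And>x. (f has_vector_derivative f' x) (at x)) \<Longrightarrow> ndiff n f' \<Longrightarrow> ndiff (Suc n) f"
  by auto

text \<open>A derivative that exists everywhere is unique, so the witness in \<open>ndiff\<close>
  can only be the \<open>vector_derivative\<close> iterated in \<open>smooth\<close>. Level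
  \<open>n\<close> speaks of the iterates below \<open>n\<close>, that is, of \<open>n\<close>
  derivatives.\<close>

lemma ndiff_iff:
  "ndiff n f \<longleftrightarrow> (\<forall>k<n. ((\<lambda>g t. vector_derivative g (at t)) ^^ k) f differentiable_on UNIV)"
proof (induction n arbitrary: f)
  case 0
  show ?case by simp
next
  case (Suc n)
  let ?D = "\<lambda>g t. vector_derivative g (at t)"
  \<comment> \<open>The power of \<open>?D\<close> unfolds at the outermost derivative, whereas
    \<open>ndiff\<close> peels off the innermost one.\<close>
  have shift: "(?D ^^ Suc k) f = (?D ^^ k) (?D f)" for k
    by (rule funpow_Suc_right[THEN fun_cong, unfolded comp_apply])
  have "ndiff (Suc n) f \<longleftrightarrow> f differentiable_on UNIV \<and> ndiff n (?D f)"
  proof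
    assume "ndiff (Suc n) f"
    then obtain f' where f': "\<And>x. (f has_vector_derivative f' x) (at x)" "ndiff n f'"
      by auto
    have "?D f = f'"
      using vector_derivative_at[OF f'(1)] by auto
    then show "f differentiable_on UNIV \<and> ndiff n (?D f)"
      using f' by (auto simp: differentiable_on_def intro: differentiableI_vector)
  next
    assume "f differentiable_on UNIV \<and> ndiff n (?D f)"
    then show "ndiff (Suc n) f"
      by (auto simp: differentiable_on_def vector_derivative_works[symmetric] intro!: exI[of _ "?D f"])
  qed
  then show ?case
    unfolding Suc.IH All_less_Suc2 shift by simp
qed

lemma smooth_iff_ndiff: "smooth f \<longleftrightarrow> (\<forall>n. ndiff n f)"
  unfolding smooth_def ndiff_iff by blast

lemma ndiff_Suc_imp: "ndiff (Suc n) f \<Longrightarrow> ndiff n f"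
  unfolding ndiff_iff by simp

declare ndiff.simps(2) [simp del]

lemma ndiff_const: "ndiff n (\<lambda>_. c)"
proof (induction n arbitrary: c)
  case (Suc n)
  show ?case
    by (rule ndiff_SucI[of _ "\<lambda>_. 0"]) (auto intro: Suc)
qed simp

lemma ndiff_bounded_linear:
  assumes "bounded_linear L" "ndiff n f"
  shows "ndiff n (\<lambda>x. L (f x))"
  using assms(2)
proof (induction n arbitrary: f)
  case (Suc n)
  obtain f' where f': "\<And>x. (f has_vector_derivative f' x) (at x)" "ndiff n f'"
    using Suc.prems unfolding ndiff.simps(2) by blast
  show ?case
    by (rule ndiff_SucI[OF bounded_linear.has_vector_derivative[OF assms(1) f'(1)] Suc.IH[OF f'(2)]])
qed simp

lemma ndiff_id: "ndiff n (\<lambda>x. x)"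
proof (cases n)
  case (Suc m)
  then show ?thesis
    by (auto simp: id_def intro!: ndiff_SucI[of _ "\<lambda>_. 1"] ndiff_const has_vector_derivative_id)
qed simp

lemma ndiff_add:
  assumes "ndiff n f" "ndiff n g"
  shows "ndiff n (\<lambda>x. f x + g x)"
  using assms
proof (induction n arbitrary: f g)
  case (Suc n)
  obtain f' where f': "\<And>x. (f has_vector_derivative f' x) (at x)" "ndiff n f'"
    using Suc.prems(1) unfolding ndiff.simps(2) by blast
  obtain g' where g': "\<And>x. (g has_vector_derivative g' x) (at x)" "ndiff n g'"
    using Suc.prems(2) unfolding ndiff.simps(2) by blast
  show ?case
    by (rule ndiff_SucI[OF has_vector_derivative_add[OF f'(1) g'(1)] Suc.IH[OF f'(2) g'(2)]])
qed simp

lemma ndiff_minus: "ndiff n f \<Longrightarrow> ndiff n (\<lambda>x. - f x)"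
  by (rule ndiff_bounded_linear[OF bounded_linear_minus[OF bounded_linear_ident]])

lemma ndiff_diff: "ndiff n f \<Longrightarrow> ndiff n g \<Longrightarrow> ndiff n (\<lambda>x. f x - g x)"
  using ndiff_add[of n f "\<lambda>x. - g x"] ndiff_minus[of n g] by simp

lemma ndiff_sum: "(\<And>i. i \<in> I \<Longrightarrow> ndiff n (f i)) \<Longrightarrow> ndiff n (\<lambda>x. \<Sum>i\<in>I. f i x)"
  by (induction I rule: infinite_finite_induct) (simp_all add: ndiff_const ndiff_add)

text \<open>The product rule brings back \<open>f\<close> and \<open>g\<close> themselves, so the
  induction lowers their level with \<open>ndiff_Suc_imp\<close>.\<close>

lemma ndiff_mult:
  fixes f g :: "real \<Rightarrow> 'a::real_normed_algebra"
  assumes "ndiff n f" "ndiff n g"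
  shows "ndiff n (\<lambda>x. f x * g x)"
  using assms
proof (induction n arbitrary: f g)
  case (Suc n)
  obtain f' where f': "\<And>x. (f has_vector_derivative f' x) (at x)" "ndiff n f'"
    using Suc.prems(1) unfolding ndiff.simps(2) by blast
  obtain g' where g': "\<And>x. (g has_vector_derivative g' x) (at x)" "ndiff n g'"
    using Suc.prems(2) unfolding ndiff.simps(2) by blast
  note d = f' g'
  have "ndiff n (\<lambda>x. f x * g' x + f' x * g x)"
    by (intro ndiff_add Suc.IH d Suc.prems[THEN ndiff_Suc_imp])
  then show ?case
    by (rule ndiff_SucI[OF has_vector_derivative_mult[OF d(1) d(3)]])
qed simp

lemma ndiff_prod:
  fixes f :: "'i \<Rightarrow> real \<Rightarrow> 'a::{real_normed_algebra,comm_ring_1}"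
  shows "(\<And>i. i \<in> I \<Longrightarrow> ndiff n (f i)) \<Longrightarrow> ndiff n (\<lambda>x. \<Prod>i\<in>I. f i x)"
  by (induction I rule: infinite_finite_induct) (simp_all add: ndiff_const ndiff_mult)

lemma ndiff_Suc_realI:
  "(\<And>x. (f has_real_derivative f' x) (at x)) \<Longrightarrow> ndiff n f' \<Longrightarrow> ndiff (Suc n) f"
  by (rule ndiff_SucI) (simp_all add: has_real_derivative_iff_has_vector_derivative)

lemma ndiff_Suc_real:
  "ndiff (Suc n) (f :: real \<Rightarrow> real) \<longleftrightarrow>
     (\<exists>f'. (\<forall>x. (f has_real_derivative f' x) (at x)) \<and> ndiff n f')"
  by (simp add: has_real_derivative_iff_has_vector_derivative ndiff.simps(2))

text \<open>Up to sign, the derivative is \<open>f'\<close> times two copies of the inverse itself,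
  to which the induction hypothesis applies. Square roots bootstrap in the same way.\<close>

lemma ndiff_inverse:
  fixes f :: "real \<Rightarrow> real"
  assumes "ndiff n f" "\<And>x. f x \<noteq> 0"
  shows "ndiff n (\<lambda>x. inverse (f x))"
  using assms(1)
proof (induction n)
  case (Suc n)
  obtain f' where f': "\<And>x. (f has_real_derivative f' x) (at x)" "ndiff n f'"
    using Suc.prems unfolding ndiff_Suc_real by blast
  have "ndiff n (\<lambda>x. - (inverse (f x) * f' x * inverse (f x)))"
    by (intro ndiff_minus ndiff_mult Suc.IH f'(2) Suc.prems[THEN ndiff_Suc_imp])
  then show ?case
    by (rule ndiff_Suc_realI[OF DERIV_inverse'[OF f'(1) assms(2)]])
qed simp

lemma ndiff_divide:
  fixes f g :: "real \<Rightarrow> real"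
  assumes "ndiff n f" "ndiff n g" "\<And>x. g x \<noteq> 0"
  shows "ndiff n (\<lambda>x. f x / g x)"
  using ndiff_mult[OF assms(1) ndiff_inverse[OF assms(2,3)]] by (simp add: divide_inverse)

lemma ndiff_sqrt:
  assumes "ndiff n f" "\<And>x. f x > 0"
  shows "ndiff n (\<lambda>x. sqrt (f x))"
  using assms(1)
proof (induction n)
  case (Suc n)
  obtain f' where f': "\<And>x. (f has_real_derivative f' x) (at x)" "ndiff n f'"
    using Suc.prems unfolding ndiff_Suc_real by blast
  have nz: "f x \<noteq> 0" for x
    using assms(2)[of x] by simp
  have d: "((\<lambda>x. sqrt (f x)) has_real_derivative f' x / (2 * sqrt (f x))) (at x)" for x
    using DERIV_chain2[of sqrt _ f x, OF DERIV_real_sqrt[OF assms(2)] f'(1)]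
    by (simp add: field_simps)
  have n: "ndiff n (\<lambda>x. f' x / (2 * sqrt (f x)))"
    by (intro ndiff_divide ndiff_mult ndiff_const Suc.IH f'(2) Suc.prems[THEN ndiff_Suc_imp])
      (simp add: nz)
  show ?case
    by (rule ndiff_Suc_realI[OF d n])
qed simp

lemma ndiff_compose:
  fixes f :: "real \<Rightarrow> 'a::real_normed_vector" and g :: "real \<Rightarrow> real"
  assumes "ndiff n f" "ndiff n g"
  shows "ndiff n (\<lambda>x. f (g x))"
  using assms
proof (induction n arbitrary: f)
  case (Suc n)
  obtain f' where f': "\<And>x. (f has_vector_derivative f' x) (at x)" "ndiff n f'"
    using Suc.prems(1) unfolding ndiff.simps(2) by blast
  obtain g' where g': "\<And>x. (g has_vector_derivative g' x) (at x)" "ndiff n g'"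
    using Suc.prems(2) unfolding ndiff.simps(2) by blast
  note d = f' g'
  \<comment> \<open>The chain rule yields a real factor times a vector, a product between two
    different types, hence a product rule of its own.\<close>
  have sc: "ndiff m (\<lambda>x. u x *\<^sub>R v x)" if "ndiff m u" "ndiff m v"
    for m and u :: "real \<Rightarrow> real" and v :: "real \<Rightarrow> 'a"
    using that
  proof (induction m arbitrary: u v)
    case (Suc m)
    obtain u' where u': "\<And>x. (u has_real_derivative u' x) (at x)" "ndiff m u'"
      using Suc.prems(1) unfolding ndiff_Suc_real by blast
    obtain v' where v': "\<And>x. (v has_vector_derivative v' x) (at x)" "ndiff m v'"
      using Suc.prems(2) unfolding ndiff.simps(2) by blast
    note e = u' v'
    have "ndiff m (\<lambda>x. u x *\<^sub>R v' x + u' x *\<^sub>R v x)"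
      by (intro ndiff_add Suc.IH e Suc.prems[THEN ndiff_Suc_imp])
    then show ?case
      by (rule ndiff_SucI[OF has_vector_derivative_scaleR[OF e(1) e(3)]])
  qed simp
  have n: "ndiff n (\<lambda>x. g' x *\<^sub>R f' (g x))"
    by (rule sc[OF d(4) Suc.IH[OF d(2) Suc.prems(2)[THEN ndiff_Suc_imp]]])
  have c: "((\<lambda>x. f (g x)) has_vector_derivative g' x *\<^sub>R f' (g x)) (at x)" for x
    using vector_diff_chain_at[OF d(3) d(1)] by (simp add: o_def)
  show ?case by (rule ndiff_SucI[OF c n])
qed simp

text \<open>The derivative is algebraic in \<open>f\<close> and \<open>f'\<close>, so the closure
  rules above settle it without an induction.\<close>

lemma ndiff_arcsin:
  assumes "ndiff n f" "\<And>x. \<bar>f x\<bar> < 1"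
  shows "ndiff n (\<lambda>x. arcsin (f x))"
proof (cases n)
  case (Suc m)
  obtain f' where f': "\<And>x. (f has_real_derivative f' x) (at x)" "ndiff m f'"
    using assms(1) unfolding Suc ndiff_Suc_real by blast
  have pos: "1 - f x * f x > 0" for x
    using assms(2)[of x] by (metis abs_square_less_1 diff_gt_0_iff_gt power2_eq_square)
  have nz: "sqrt (1 - f x * f x) \<noteq> 0" for x
    using pos[of x] by simp
  have d: "((\<lambda>x. arcsin (f x)) has_real_derivative f' x / sqrt (1 - f x * f x)) (at x)" for x
  proof -
    have "- 1 < f x" "f x < 1" using assms(2)[of x] by linarith+
    from DERIV_chain2[of arcsin _ f x, OF DERIV_arcsin[OF this] f'(1)] show ?thesis
      by (simp add: field_simps power2_eq_square)
  qed
  have n: "ndiff m (\<lambda>x. f' x / sqrt (1 - f x * f x))"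
    by (intro ndiff_divide ndiff_sqrt ndiff_diff ndiff_mult ndiff_const f'(2)
        assms(1)[unfolded Suc, THEN ndiff_Suc_imp] pos nz)
  show ?thesis
    unfolding Suc by (rule ndiff_Suc_realI[OF d n])
qed simp

text \<open>Each level of \<open>ndiff\<close> supplies its own derivative; uniqueness of
  derivatives makes one \<open>f'\<close> serve all levels.\<close>

lemma smooth_has_derivative:
  assumes "smooth f"
  shows "\<exists>f'. (\<forall>x. (f has_vector_derivative f' x) (at x)) \<and> smooth f'"
proof -
  have S: "ndiff (Suc n) f" for n
    using assms unfolding smooth_iff_ndiff ..
  from S[of 0] obtain f' where f': "\<And>x. (f has_vector_derivative f' x) (at x)"
    unfolding ndiff.simps(2) by blast
  have "ndiff n f'" for n
  proof -
    from S[of n] obtain g where g: "\<And>x. (f has_vector_derivative g x) (at x)" "ndiff n g"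
      unfolding ndiff.simps(2) by blast
    have "g = f'" using vector_derivative_unique_at[OF g(1) f'] by auto
    then show ?thesis using g(2) by simp
  qed
  then show ?thesis using f' unfolding smooth_iff_ndiff by blast
qed

lemma smooth_imp_continuous: "smooth f \<Longrightarrow> isCont f x"
  by (blast dest: smooth_has_derivative intro: has_vector_derivative_continuous)

text \<open>Hadamard's lemma: \<open>f x\<close> is the integral over \<open>t\<close> from 0 to 1
  of the derivative of \<open>f (x * t)\<close>, which is \<open>x\<close> times the integral of
  \<open>f' (x * t)\<close>. It is what allows smooth division by \<open>h\<close>, both for matrix
  entries and for angles.\<close>

lemma smooth_hadamard:
  fixes f :: "real \<Rightarrow> real"
  assumes "smooth f" "f 0 = 0"
  obtains g where "smooth g" "\<And>x. f x = x * g x"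
proof -
  obtain f' where f': "\<And>x. (f has_vector_derivative f' x) (at x)" "smooth f'"
    using smooth_has_derivative[OF assms(1)] by blast
  \<comment> \<open>Each differentiation in \<open>x\<close> under the integral pulls out one factor
    \<open>t\<close>, so the induction has to allow an arbitrary weight
    \<open>t ^ k\<close>.\<close>
  let ?G = "\<lambda>k u x. integral (cbox 0 1) (\<lambda>t. t ^ k * u (x * t))"
  have G: "ndiff n (?G k u)" if "smooth u" for n k and u :: "real \<Rightarrow> real"
    using that
  proof (induction n arbitrary: k u)
    case (Suc n)
    obtain u' where u': "\<And>x. (u has_vector_derivative u' x) (at x)" "smooth u'"
      using smooth_has_derivative[OF Suc.prems] by blast
    have cu: "continuous_on UNIV u" and cu': "continuous_on UNIV u'"
      using smooth_imp_continuous[OF Suc.prems] smooth_imp_continuous[OF u'(2)]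
      by (auto intro: continuous_at_imp_continuous_on)
    have "(?G k u has_field_derivative ?G (Suc k) u' x0) (at x0 within UNIV)" for x0
    proof (rule leibniz_rule_field_derivative)
      fix x t :: real
      have "(u has_real_derivative u' (x * t)) (at (x * t))"
        using u'(1) by (simp add: has_real_derivative_iff_has_vector_derivative)
      then have "((\<lambda>x. u (x * t)) has_real_derivative u' (x * t) * t) (at x)"
        by (rule DERIV_chain2) (auto intro!: derivative_eq_intros)
      from DERIV_cmult[OF this, of "t ^ k"]
      show "((\<lambda>x. t ^ k * u (x * t)) has_real_derivative t ^ Suc k * u' (x * t)) (at x)"
        by (simp add: mult_ac)
    next
      fix x :: real
      show "(\<lambda>t. t ^ k * u (x * t)) integrable_on cbox 0 1"
        by (intro integrable_continuous continuous_intros continuous_on_compose2[OF cu]) auto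
    next
      show "continuous_on (UNIV \<times> cbox 0 1) (\<lambda>(x, t). t ^ Suc k * u' (x * t))"
        unfolding split_beta
        by (intro continuous_intros continuous_on_compose2[OF cu']) auto
    qed auto
    then show ?case
      by (intro ndiff_Suc_realI[OF _ Suc.IH[OF u'(2), of "Suc k"]]) simp
  qed simp
  have "f x = x * ?G 0 f' x" for x
  proof -
    have "((\<lambda>t. f (x * t)) has_vector_derivative x * f' (x * t)) (at t within {0..1})" for t
    proof -
      have "(f has_real_derivative f' (x * t)) (at (x * t))"
        using f'(1) by (simp add: has_real_derivative_iff_has_vector_derivative)
      then have "((\<lambda>t. f (x * t)) has_real_derivative f' (x * t) * x) (at t)"
        by (rule DERIV_chain2) (auto intro!: derivative_eq_intros)
      then show ?thesis
        by (simp add: has_real_derivative_iff_has_vector_derivative has_vector_derivative_at_within mult.commute)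
    qed
    then have "((\<lambda>t. x * f' (x * t)) has_integral f (x * 1) - f (x * 0)) {0..1}"
      by (intro fundamental_theorem_of_calculus) auto
    then show ?thesis
      using assms(2) by (auto dest!: integral_unique)
  qed
  moreover have "smooth (?G 0 f')"
    unfolding smooth_iff_ndiff using G[OF f'(2)] by blast
  ultimately show ?thesis using that by blast
qed

section \<open>Flat functions and a smooth cutoff\<close>

lemma poly_div_exp_tendsto_0: "((\<lambda>y. poly q y * exp (- y)) \<longlongrightarrow> (0::real)) at_top"
proof -
  have "((\<lambda>y. \<Sum>i\<le>degree q. coeff q i * (y ^ i / exp y)) \<longlongrightarrow> (\<Sum>i\<le>degree q. coeff q i * 0)) at_top"
    by (intro tendsto_intros tendsto_power_div_exp_0)
  then show ?thesis
    by (simp add: poly_altdef sum_distrib_right exp_minus field_simps sum_divide_distrib)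
qed

text \<open>The derivatives of \<open>exp (- 1 / x)\<close> are polynomials in \<open>1 / x\<close> times \<open>exp (- 1 / x)\<close>, and
  all of these extend by \<open>0\<close> to the left of the origin.\<close>

lemma ndiff_flat:
  "ndiff n (\<lambda>x::real. if 0 < x then poly q (1 / x) * exp (- (1 / x)) else 0)"
proof (induction n arbitrary: q)
  case (Suc n)
  let ?g = "\<lambda>q x::real. if 0 < x then poly q (1 / x) * exp (- (1 / x)) else 0"
  \<comment> \<open>With \<open>y = 1 / x\<close>, differentiation in \<open>x\<close> is
    \<open>- y^2\<close> times differentiation in \<open>y\<close>, which turns \<open>q\<close>
    into \<open>y^2 * (q - pderiv q)\<close>.\<close>
  define q' where "q' = [:0, 0, 1:] * (q - pderiv q)"
  have "(?g q has_real_derivative ?g q' x) (at x)" for x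
  proof -
    consider "x > 0" | "x < 0" | "x = 0" by linarith
    then show ?thesis
    proof cases
      case 1
      have "((\<lambda>x. poly q (1 / x) * exp (- (1 / x))) has_real_derivative
          poly q (1 / x) * (exp (- (1 / x)) * (1 / x\<^sup>2)) + poly (pderiv q) (1 / x) * (- (1 / x\<^sup>2)) * exp (- (1 / x))) (at x)"
        using 1 by (auto intro!: derivative_eq_intros DERIV_chain2[OF poly_DERIV] simp: power2_eq_square)
      then have "((\<lambda>x. poly q (1 / x) * exp (- (1 / x))) has_real_derivative ?g q' x) (at x)"
        using 1 by (simp add: q'_def algebra_simps power2_eq_square)
      then show ?thesis
        by (rule has_field_derivative_transform_within_open[of _ _ _ "{0<..}"]) (use 1 in auto)
    next
      case 2
      have "((\<lambda>x. 0) has_real_derivative ?g q' x) (at x)" using 2 by simp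
      then show ?thesis
        by (rule has_field_derivative_transform_within_open[of _ _ _ "{..<0}"]) (use 2 in auto)
    next
      case 3
      \<comment> \<open>The difference quotient at the origin carries an extra factor
        \<open>1 / x\<close>, whence the shifted polynomial \<open>pCons 0 q\<close>.\<close>
      have "((\<lambda>y. poly (pCons 0 q) y * exp (- y)) \<longlongrightarrow> 0) at_top"
        by (rule poly_div_exp_tendsto_0)
      from filterlim_compose[OF this filterlim_inverse_at_top_right]
      have "((\<lambda>y. ?g q y / y) \<longlongrightarrow> 0) (at_right 0)"
        by (rule Lim_transform_eventually)
          (auto simp: eventually_at_right_field field_simps intro!: exI[of _ 1])
      moreover have "((\<lambda>y. ?g q y / y) \<longlongrightarrow> 0) (at_left 0)"
        by (rule Lim_transform_eventually[OF tendsto_const])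
          (auto simp: eventually_at_left_field intro!: exI[of _ "-1"])
      ultimately have "((\<lambda>y. ?g q y / y) \<longlongrightarrow> 0) (at 0)"
        by (rule filterlim_split_at[rotated])
      then show ?thesis
        unfolding 3 has_field_derivative_iff by simp
    qed
  qed
  then show ?case
    by (rule ndiff_Suc_realI[OF _ Suc.IH[of q']])
qed simp

text \<open>The factor \<open>?a / (?a + ?b)\<close> is a bump: \<open>?a\<close> vanishes for
  \<open>\<bar>x\<bar> \<ge> \<delta>\<close> and \<open>?b\<close> for
  \<open>\<bar>x\<bar> \<le> \<delta> / 2\<close>. Composition with \<open>\<phi>\<close> makes a
  function that is smooth on \<open>\<bar>x\<bar> < \<delta>\<close> smooth on the whole line and
  leaves it unchanged near the origin.\<close>

lemma smooth_cutoff: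
  assumes "\<delta> > (0::real)"
  obtains \<phi> :: "real \<Rightarrow> real" where "smooth \<phi>" "\<And>x. \<bar>\<phi> x\<bar> < \<delta>"
    "\<And>x. \<bar>x\<bar> \<le> \<delta> / 2 \<Longrightarrow> \<phi> x = x"
proof -
  let ?E = "\<lambda>x::real. if 0 < x then poly [:1:] (1 / x) * exp (- (1 / x)) else 0"
  let ?u = "\<lambda>x::real. x / \<delta>"
  let ?a = "\<lambda>x. ?E (1 - ?u x * ?u x)" and ?b = "\<lambda>x. ?E (?u x * ?u x - 1 / 4)"
  define \<phi> where "\<phi> x = x * (?a x / (?a x + ?b x))" for x
  have E: "?E t \<ge> 0" "t > 0 \<Longrightarrow> ?E t > 0" for t
    by auto
  have ab: "?a x + ?b x > 0" "?a x \<ge> 0" "?b x \<ge> 0" for x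
  proof -
    show nn: "?a x \<ge> 0" "?b x \<ge> 0" by (rule E)+
    \<comment> \<open>The two supports overlap and cover the line, so the denominator never
      vanishes.\<close>
    have "1 - ?u x * ?u x > 0 \<or> ?u x * ?u x - 1 / 4 > 0" by argo
    then show "?a x + ?b x > 0"
      using nn E(2)[of "1 - ?u x * ?u x"] E(2)[of "?u x * ?u x - 1 / 4"]
      by (metis add_pos_nonneg add_nonneg_pos)
  qed
  have na: "ndiff n ?a" for n
    by (rule ndiff_compose[OF ndiff_flat, of _ "\<lambda>x. 1 - ?u x * ?u x"])
      (use assms in \<open>intro ndiff_diff ndiff_mult ndiff_const ndiff_id ndiff_divide; simp\<close>)
  have nb: "ndiff n ?b" for n
    by (rule ndiff_compose[OF ndiff_flat, of _ "\<lambda>x. ?u x * ?u x - 1 / 4"])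
      (use assms in \<open>intro ndiff_diff ndiff_mult ndiff_const ndiff_id ndiff_divide; simp\<close>)
  have "smooth \<phi>"
    unfolding \<phi>_def smooth_iff_ndiff
    by (intro allI ndiff_mult ndiff_id ndiff_divide ndiff_add na nb less_imp_neq[OF ab(1), THEN not_sym])
  moreover have "\<bar>\<phi> x\<bar> < \<delta>" for x
  proof (cases "\<bar>x\<bar> < \<delta>")
    case True
    have "\<bar>?a x / (?a x + ?b x)\<bar> \<le> 1"
      using ab[of x] by (simp add: divide_le_eq del: poly_pCons)
    then have "\<bar>\<phi> x\<bar> \<le> \<bar>x\<bar>"
      unfolding \<phi>_def abs_mult[of x] by (rule mult_left_le) simp
    then show ?thesis using True by simp
  next
    case False
    then have "1 \<le> \<bar>?u x\<bar>" using assms by simp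
    then have "1 \<le> ?u x * ?u x"
      by (metis abs_le_square_iff abs_one one_power2 power2_eq_square)
    then show ?thesis using assms by (simp add: \<phi>_def)
  qed
  moreover have "\<phi> x = x" if "\<bar>x\<bar> \<le> \<delta> / 2" for x
  proof -
    have "\<bar>?u x\<bar> \<le> \<bar>1 / 2\<bar>" using assms that by (simp add: field_simps)
    then have "?u x * ?u x \<le> 1 / 4"
      unfolding abs_le_square_iff by (simp add: power2_eq_square)
    then have u: "1 - ?u x * ?u x > 0" "\<not> ?u x * ?u x - 1 / 4 > 0" by argo+
    have "?a x > 0" by (rule E(2)[OF u(1)])
    moreover have "?b x = 0" by (rule if_not_P[OF u(2)])
    ultimately show ?thesis by (simp add: \<phi>_def del: poly_pCons)
  qed
  ultimately show ?thesis using that by blast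
qed

section \<open>An implicit function theorem\<close>

text \<open>\<open>Q\<close> is the divided difference of \<open>F\<close> in its second argument and \<open>F'\<close> the partial derivative in
  the first one. The last clause is what bootstraps the differentiability of an implicit function.\<close>

definition admissible :: "(real \<Rightarrow> real \<Rightarrow> real) \<Rightarrow> bool" where
  "admissible F \<longleftrightarrow> (\<exists>Q F'.
     (\<forall>h z w. F h z - F h w = (z - w) * Q h z w) \<and>
     continuous_on UNIV (\<lambda>p. Q (fst p) (fst (snd p)) (snd (snd p))) \<and>
     continuous_on UNIV (\<lambda>p. F (fst p) (snd p)) \<and>
     (\<forall>h w. ((\<lambda>h. F h w) has_real_derivative F' h w) (at h)) \<and>
     (\<forall>n \<phi> \<mu>. ndiff n \<phi> \<longrightarrow> ndiff n \<mu> \<longrightarrow>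
        ndiff n (\<lambda>h. F (\<phi> h) (\<mu> h)) \<and> ndiff n (\<lambda>h. Q (\<phi> h) (\<mu> h) (\<mu> h)) \<and>
        ndiff n (\<lambda>h. F' (\<phi> h) (\<mu> h))))"

lemma admissible_coeff:
  assumes "smooth a"
  shows "admissible (\<lambda>h z. a h)"
proof -
  obtain a' where a': "\<And>x. (a has_vector_derivative a' x) (at x)" "smooth a'"
    using smooth_has_derivative[OF assms] by blast
  have "ndiff n (\<lambda>h. a (\<phi> h))" "ndiff n (\<lambda>h. a' (\<phi> h))" if "ndiff n \<phi>" for n \<phi>
    using that assms a'(2) by (simp_all add: ndiff_compose smooth_iff_ndiff)
  moreover have "continuous_on UNIV a"
    using smooth_imp_continuous[OF assms] by (simp add: continuous_at_imp_continuous_on)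
  ultimately show ?thesis
    unfolding admissible_def using a'(1)
    by (intro exI[of _ "\<lambda>_ _ _. 0"] exI[of _ "\<lambda>h _. a' h"])
      (auto simp: ndiff_const has_real_derivative_iff_has_vector_derivative
        intro!: continuous_intros elim: continuous_on_compose2)
qed

lemma admissible_var: "admissible (\<lambda>h z. z)"
  unfolding admissible_def
  by (intro exI[of _ "\<lambda>_ _ _. 1"] exI[of _ "\<lambda>_ _. 0"])
    (auto simp: ndiff_const intro!: continuous_intros)

lemma admissible_add:
  assumes "admissible F" "admissible G"
  shows "admissible (\<lambda>h z. F h z + G h z)"
proof -
  obtain Q F' where F:
    "\<And>h z w. F h z - F h w = (z - w) * Q h z w"
    "continuous_on UNIV (\<lambda>p. Q (fst p) (fst (snd p)) (snd (snd p)))"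
    "continuous_on UNIV (\<lambda>p. F (fst p) (snd p))"
    "\<And>h w. ((\<lambda>h. F h w) has_real_derivative F' h w) (at h)"
    "\<And>n \<phi> \<mu>. ndiff n \<phi> \<Longrightarrow> ndiff n \<mu> \<Longrightarrow>
        ndiff n (\<lambda>h. F (\<phi> h) (\<mu> h)) \<and> ndiff n (\<lambda>h. Q (\<phi> h) (\<mu> h) (\<mu> h)) \<and>
        ndiff n (\<lambda>h. F' (\<phi> h) (\<mu> h))"
    using assms(1) unfolding admissible_def by blast
  obtain R G' where G:
    "\<And>h z w. G h z - G h w = (z - w) * R h z w"
    "continuous_on UNIV (\<lambda>p. R (fst p) (fst (snd p)) (snd (snd p)))"
    "continuous_on UNIV (\<lambda>p. G (fst p) (snd p))"
    "\<And>h w. ((\<lambda>h. G h w) has_real_derivative G' h w) (at h)"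
    "\<And>n \<phi> \<mu>. ndiff n \<phi> \<Longrightarrow> ndiff n \<mu> \<Longrightarrow>
        ndiff n (\<lambda>h. G (\<phi> h) (\<mu> h)) \<and> ndiff n (\<lambda>h. R (\<phi> h) (\<mu> h) (\<mu> h)) \<and>
        ndiff n (\<lambda>h. G' (\<phi> h) (\<mu> h))"
    using assms(2) unfolding admissible_def by blast
  have "F h z + G h z - (F h w + G h w) = (z - w) * (Q h z w + R h z w)" for h z w
    using F(1)[of h z w] G(1)[of h z w] by (simp add: algebra_simps)
  then show ?thesis
    unfolding admissible_def using F G
    by (intro exI[of _ "\<lambda>h z w. Q h z w + R h z w"] exI[of _ "\<lambda>h w. F' h w + G' h w"])
      (auto intro!: continuous_on_add DERIV_add ndiff_add)
qed

lemma admissible_mult: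
  assumes "admissible F" "admissible G"
  shows "admissible (\<lambda>h z. F h z * G h z)"
proof -
  obtain Q F' where F:
    "\<And>h z w. F h z - F h w = (z - w) * Q h z w"
    "continuous_on UNIV (\<lambda>p. Q (fst p) (fst (snd p)) (snd (snd p)))"
    "continuous_on UNIV (\<lambda>p. F (fst p) (snd p))"
    "\<And>h w. ((\<lambda>h. F h w) has_real_derivative F' h w) (at h)"
    "\<And>n \<phi> \<mu>. ndiff n \<phi> \<Longrightarrow> ndiff n \<mu> \<Longrightarrow>
        ndiff n (\<lambda>h. F (\<phi> h) (\<mu> h)) \<and> ndiff n (\<lambda>h. Q (\<phi> h) (\<mu> h) (\<mu> h)) \<and>
        ndiff n (\<lambda>h. F' (\<phi> h) (\<mu> h))"
    using assms(1) unfolding admissible_def by blast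
  obtain R G' where G:
    "\<And>h z w. G h z - G h w = (z - w) * R h z w"
    "continuous_on UNIV (\<lambda>p. R (fst p) (fst (snd p)) (snd (snd p)))"
    "continuous_on UNIV (\<lambda>p. G (fst p) (snd p))"
    "\<And>h w. ((\<lambda>h. G h w) has_real_derivative G' h w) (at h)"
    "\<And>n \<phi> \<mu>. ndiff n \<phi> \<Longrightarrow> ndiff n \<mu> \<Longrightarrow>
        ndiff n (\<lambda>h. G (\<phi> h) (\<mu> h)) \<and> ndiff n (\<lambda>h. R (\<phi> h) (\<mu> h) (\<mu> h)) \<and>
        ndiff n (\<lambda>h. G' (\<phi> h) (\<mu> h))"
    using assms(2) unfolding admissible_def by blast
  have 1: "F h z * G h z - F h w * G h w = (z - w) * (Q h z w * G h z + F h w * R h z w)" for h z w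
  proof -
    have "F h z * G h z - F h w * G h w = (F h z - F h w) * G h z + F h w * (G h z - G h w)"
      by (simp add: algebra_simps)
    then show ?thesis unfolding F(1) G(1) by (simp add: algebra_simps)
  qed
  have 2: "continuous_on UNIV (\<lambda>p. Q (fst p) (fst (snd p)) (snd (snd p)) * G (fst p) (fst (snd p))
      + F (fst p) (snd (snd p)) * R (fst p) (fst (snd p)) (snd (snd p)))"
  proof (intro continuous_on_add continuous_on_mult F(2) G(2))
    show "continuous_on UNIV (\<lambda>p. G (fst p) (fst (snd p)))"
      using continuous_on_compose2[OF G(3), of UNIV "\<lambda>p. (fst p, fst (snd p))"]
      by (simp add: continuous_intros)
    show "continuous_on UNIV (\<lambda>p. F (fst p) (snd (snd p)))"
      using continuous_on_compose2[OF F(3), of UNIV "\<lambda>p. (fst p, snd (snd p))"]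
      by (simp add: continuous_intros)
  qed
  have 3: "((\<lambda>h. F h w * G h w) has_real_derivative F' h w * G h w + G' h w * F h w) (at h)" for h w
    by (rule DERIV_mult[OF F(4) G(4)])
  show ?thesis
    unfolding admissible_def
    by (rule exI[of _ "\<lambda>h z w. Q h z w * G h z + F h w * R h z w"],
        rule exI[of _ "\<lambda>h w. F' h w * G h w + G' h w * F h w"])
      (use F(3,5) G(3,5) 1 2 3 in \<open>auto intro!: continuous_on_mult ndiff_add ndiff_mult\<close>)
qed

lemma admissible_sum: "(\<And>i. i \<in> I \<Longrightarrow> admissible (F i)) \<Longrightarrow> admissible (\<lambda>h z. \<Sum>i\<in>I. F i h z)"
  by (induction I rule: infinite_finite_induct)
    (simp_all add: admissible_add admissible_coeff smooth_iff_ndiff ndiff_const)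

lemma admissible_prod: "(\<And>i. i \<in> I \<Longrightarrow> admissible (F i)) \<Longrightarrow> admissible (\<lambda>h z. \<Prod>i\<in>I. F i h z)"
  by (induction I rule: infinite_finite_induct)
    (simp_all add: admissible_mult admissible_coeff smooth_iff_ndiff ndiff_const)

text \<open>The Leibniz expansion is a finite sum of products of smooth coefficients and of the
  variable \<open>z\<close>, so the closure rules apply. Implicit functions of this determinant are
  the eigenvalues.\<close>

lemma admissible_det:
  fixes C :: "real \<Rightarrow> real^'n^'n"
  assumes "\<And>i j. smooth (\<lambda>h. C h $ i $ j)"
  shows "admissible (\<lambda>h z. det (mat z - C h))"
proof -
  have "admissible (\<lambda>h z. (mat z - C h) $ i $ j)" for i j
  proof -
    have "smooth (\<lambda>h. - (C h $ i $ j))"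
      using assms by (simp add: smooth_iff_ndiff ndiff_minus)
    from admissible_add[OF admissible_var admissible_coeff[OF this]] admissible_coeff[OF this]
    show ?thesis by (cases "i = j") (simp_all add: mat_def)
  qed
  then show ?thesis
    unfolding det_def
    by (intro admissible_sum admissible_mult admissible_prod admissible_coeff)
      (simp_all add: smooth_iff_ndiff ndiff_const)
qed

text \<open>The cutoff makes the implicitly defined function smooth on the whole line; it solves the
  equation near the origin only.\<close>

lemma admissible_implicit:
  assumes adm: "admissible F" and F0: "F 0 z0 = 0"
    and der: "(F 0 has_real_derivative c) (at z0)" and c: "c \<noteq> 0"
  obtains \<mu> where "smooth \<mu>" "\<mu> 0 = z0" "\<forall>\<^sub>F h in nhds 0. F h (\<mu> h) = 0"
    "\<And>\<sigma>. (\<sigma> \<longlongrightarrow> z0) (at 0) \<Longrightarrow> (\<lambda>h. \<mu> h - \<sigma> h) \<in> O[at 0](\<lambda>h. F h (\<sigma> h))"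
proof -
  obtain Q F' where F:
    "\<And>h z w. F h z - F h w = (z - w) * Q h z w"
    "continuous_on UNIV (\<lambda>p. Q (fst p) (fst (snd p)) (snd (snd p)))"
    "continuous_on UNIV (\<lambda>p. F (fst p) (snd p))"
    "\<And>h w. ((\<lambda>h. F h w) has_real_derivative F' h w) (at h)"
    "\<And>n \<phi> \<mu>. ndiff n \<phi> \<Longrightarrow> ndiff n \<mu> \<Longrightarrow>
        ndiff n (\<lambda>h. F (\<phi> h) (\<mu> h)) \<and> ndiff n (\<lambda>h. Q (\<phi> h) (\<mu> h) (\<mu> h)) \<and>
        ndiff n (\<lambda>h. F' (\<phi> h) (\<mu> h))"
    using adm unfolding admissible_def by blast
  have Qlim: "((\<lambda>x. Q (f x) (g x) (k x)) \<longlongrightarrow> Q a b d) G"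
    if "(f \<longlongrightarrow> a) G" "(g \<longlongrightarrow> b) G" "(k \<longlongrightarrow> d) G" for f g k :: "real \<Rightarrow> real" and a b d G
    using continuous_on_tendsto_compose[OF F(2), of "\<lambda>x. (f x, g x, k x)" "(a, b, d)" G]
      tendsto_Pair[OF that(1) tendsto_Pair[OF that(2,3)]] by simp
  have Fcont: "continuous_on UNIV (F h)" for h
    using continuous_on_compose2[OF F(3), of UNIV "\<lambda>z. (h, z)"]
    by (simp add: continuous_on_Pair)
  \<comment> \<open>On the diagonal the divided difference is the partial derivative in the second
    argument.\<close>
  have Q0: "Q 0 z0 z0 = c"
  proof (rule tendsto_unique[of "at z0"])
    show "((\<lambda>z. Q 0 z z0) \<longlongrightarrow> Q 0 z0 z0) (at z0)"
      by (intro Qlim tendsto_intros)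
    show "((\<lambda>z. Q 0 z z0) \<longlongrightarrow> c) (at z0)"
      using der unfolding has_field_derivative_iff F(1)
      by (rule Lim_transform_eventually) (auto simp: eventually_at_filter)
  qed simp
  \<comment> \<open>Multiplying by \<open>c\<close> throughout avoids a case distinction on the sign
    of \<open>c\<close>.\<close>
  have cc: "c * c > 0" using c not_real_square_gt_zero by blast
  have "((\<lambda>p. c * Q (fst p) (fst (snd p)) (snd (snd p))) \<longlongrightarrow> c * c) (nhds (0, z0, z0))"
    using continuous_on_tendsto_compose[OF F(2) filterlim_ident, of "(0, z0, z0)"] Q0
    by (intro tendsto_intros) simp
  moreover have "c * c / 2 < c * c" using cc by simp
  ultimately have "\<forall>\<^sub>F p in nhds (0, z0, z0). c * c / 2 < c * Q (fst p) (fst (snd p)) (snd (snd p))"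
    by (rule order_tendstoD(1))
  then obtain e where e: "e > 0"
    "\<And>h z w. dist (h, z, w) (0, z0, z0) < e \<Longrightarrow> c * c / 2 < c * Q h z w"
    unfolding eventually_nhds_metric by fastforce
  \<comment> \<open>The distance of the triples is at most the sum of three absolute values, each at
    most \<open>r\<close>, and \<open>3 * e / 4 < e\<close>.\<close>
  define r where "r = e / 4"
  have r: "r > 0" using e by (simp add: r_def)
  have Qpos: "c * c / 2 < c * Q h z w" if "\<bar>h\<bar> \<le> r" "\<bar>z - z0\<bar> \<le> r" "\<bar>w - z0\<bar> \<le> r" for h z w
  proof (rule e(2))
    have "dist (h, z, w) (0, z0, z0) \<le> \<bar>h\<bar> + (\<bar>z - z0\<bar> + \<bar>w - z0\<bar>)"
      unfolding dist_Pair_Pair dist_real_def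
      by (intro order_trans[OF sqrt_sum_squares_le_sum_abs] add_mono) (simp_all add: sqrt_sum_squares_le_sum_abs)
    then show "dist (h, z, w) (0, z0, z0) < e"
      using that e(1) unfolding r_def by linarith
  qed
  have sgn: "c * F 0 (z0 + r) > 0" "c * F 0 (z0 - r) < 0"
  proof -
    have "c * F 0 (z0 + r) = r * (c * Q 0 (z0 + r) z0)"
      using F(1)[of 0 "z0 + r" z0] F0 by simp
    moreover have "c * Q 0 (z0 + r) z0 > 0"
      using Qpos[of 0 "z0 + r" z0] r cc by simp
    ultimately show "c * F 0 (z0 + r) > 0" by (metis mult_pos_pos r)
    have "c * F 0 (z0 - r) = - (r * (c * Q 0 (z0 - r) z0))"
      using F(1)[of 0 "z0 - r" z0] F0 by simp
    moreover have "c * Q 0 (z0 - r) z0 > 0"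
      using Qpos[of 0 "z0 - r" z0] r cc by simp
    ultimately show "c * F 0 (z0 - r) < 0" by (metis mult_pos_pos neg_less_0_iff_less r)
  qed
  have Fh: "((\<lambda>h. c * F h w) \<longlongrightarrow> c * F 0 w) (nhds 0)" for w
    using DERIV_isCont[OF F(4)[of w 0]] by (intro tendsto_intros) (simp add: continuous_at tendsto_nhds_iff)
  have "\<forall>\<^sub>F h in nhds 0. c * F h (z0 + r) > 0 \<and> c * F h (z0 - r) < 0"
    using order_tendstoD(1)[OF Fh sgn(1)] order_tendstoD(2)[OF Fh sgn(2)]
    by (rule eventually_conj)
  then obtain d where d: "d > 0"
    "\<And>h. \<bar>h\<bar> < d \<Longrightarrow> c * F h (z0 + r) > 0 \<and> c * F h (z0 - r) < 0"
    unfolding eventually_nhds_metric by (auto simp: dist_real_def)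
  define \<delta> where "\<delta> = min d r"
  have \<delta>: "\<delta> > 0" "\<delta> \<le> d" "\<delta> \<le> r" using d r by (auto simp: \<delta>_def)
  have "\<exists>z. \<bar>z - z0\<bar> \<le> r \<and> F h z = 0" if "\<bar>h\<bar> < \<delta>" for h
  proof -
    have "\<exists>z. z0 - r \<le> z \<and> z \<le> z0 + r \<and> c * F h z = 0"
      using d(2)[of h] that \<delta> r Fcont[of h]
      by (intro IVT') (auto intro!: continuous_on_mult continuous_on_const elim: continuous_on_subset)
    then obtain z where "z0 - r \<le> z" "z \<le> z0 + r" "F h z = 0"
      using c by auto
    then have "\<bar>z - z0\<bar> \<le> r \<and> F h z = 0" by auto
    then show ?thesis by blast
  qed
  \<comment> \<open>So far \<open>m\<close> is an arbitrary choice of roots between the two sign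
    changes; \<open>key\<close> is what makes it continuous and then differentiable.\<close>
  then obtain m where m: "\<And>h. \<bar>h\<bar> < \<delta> \<Longrightarrow> \<bar>m h - z0\<bar> \<le> r \<and> F h (m h) = 0"
    by metis
  \<comment> \<open>A residual bound: since \<open>Q\<close> stays at least
    \<open>\<bar>c\<bar> / 2\<close> in absolute value, the root differs from any nearby
    \<open>w\<close> by a multiple of \<open>F h w\<close>. Taking \<open>w = m h'\<close> at a
    fixed \<open>h'\<close> gives continuity, taking \<open>w = \<sigma> h\<close> the asymptotic
    estimate.\<close>
  have key: "\<bar>m h - w\<bar> \<le> \<bar>2 / c\<bar> * \<bar>F h w\<bar>" "(m h - w) * Q h (m h) w = - F h w"
    if "\<bar>h\<bar> < \<delta>" "\<bar>w - z0\<bar> \<le> r" for h w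
  proof -
    show eq: "(m h - w) * Q h (m h) w = - F h w"
      using F(1)[of h "m h" w] m[OF that(1)] by simp
    have "c * c / 2 < c * Q h (m h) w"
      using that m[of h] \<delta> by (intro Qpos) auto
    then have "\<bar>c\<bar> * \<bar>c\<bar> / 2 \<le> \<bar>c\<bar> * \<bar>Q h (m h) w\<bar>"
      by (metis abs_ge_self abs_mult abs_mult_self_eq less_eq_real_def order_less_le_trans)
    then have "\<bar>c\<bar> * (\<bar>c\<bar> / 2) \<le> \<bar>c\<bar> * \<bar>Q h (m h) w\<bar>" by simp
    moreover have "\<bar>c\<bar> > 0" using c by simp
    ultimately have "\<bar>c\<bar> / 2 \<le> \<bar>Q h (m h) w\<bar>"
      by (rule mult_left_le_imp_le)
    then have "\<bar>m h - w\<bar> * (\<bar>c\<bar> / 2) \<le> \<bar>m h - w\<bar> * \<bar>Q h (m h) w\<bar>"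
      by (rule mult_left_mono) simp
    also have "\<dots> = \<bar>F h w\<bar>" using eq by (metis abs_minus_cancel abs_mult)
    finally show "\<bar>m h - w\<bar> \<le> \<bar>2 / c\<bar> * \<bar>F h w\<bar>"
      using c by (simp add: field_simps)
  qed
  have m0: "m 0 = z0"
    using key(1)[of 0 z0] \<delta> r F0 by simp
  have near: "\<forall>\<^sub>F x in at h. \<bar>x\<bar> < \<delta>" if "\<bar>h\<bar> < \<delta>" for h
    using order_tendstoD(2)[OF tendsto_rabs[OF tendsto_ident_at] that] .
  have Fx: "((\<lambda>x. F x (m h)) \<longlongrightarrow> 0) (at h)" if "\<bar>h\<bar> < \<delta>" for h
    using DERIV_isCont[OF F(4)[of "m h" h]] m[OF that] by (simp add: isCont_def)
  have mcont: "(m \<longlongrightarrow> m h) (at h)" if h: "\<bar>h\<bar> < \<delta>" for h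
  proof -
    have "((\<lambda>x. \<bar>2 / c\<bar> * \<bar>F x (m h)\<bar>) \<longlongrightarrow> \<bar>2 / c\<bar> * \<bar>0\<bar>) (at h)"
      by (intro tendsto_intros Fx h)
    then have lim: "((\<lambda>x. \<bar>2 / c\<bar> * \<bar>F x (m h)\<bar>) \<longlongrightarrow> 0) (at h)" by simp
    have "\<forall>\<^sub>F x in at h. norm (m x - m h) \<le> \<bar>2 / c\<bar> * \<bar>F x (m h)\<bar>"
      using near[OF h] by eventually_elim (use key(1) m[OF h] in auto)
    from Lim_null_comparison[OF this lim] show ?thesis by (rule LIM_zero_cancel)
  qed
  have Qnz: "Q x (m x) (m h) \<noteq> 0" if "\<bar>x\<bar> < \<delta>" "\<bar>h\<bar> < \<delta>" for x h
    using Qpos[of x "m x" "m h"] m[OF that(1)] m[OF that(2)] that \<delta> cc by auto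
  \<comment> \<open>By \<open>key\<close>, the difference quotient of \<open>m\<close> is minus that
    of \<open>F\<close> in its first argument, divided by \<open>Q x (m x) (m h)\<close>; both parts
    converge.\<close>
  have mder: "(m has_real_derivative - F' h (m h) / Q h (m h) (m h)) (at h)" if h: "\<bar>h\<bar> < \<delta>" for h
  proof -
    have "((\<lambda>x. - ((F x (m h) - F h (m h)) / (x - h)) / Q x (m x) (m h)) \<longlongrightarrow>
        - F' h (m h) / Q h (m h) (m h)) (at h)"
      by (rule tendsto_divide[OF tendsto_minus[OF F(4)[unfolded has_field_derivative_iff]]
            Qlim[OF tendsto_ident_at mcont[OF h] tendsto_const] Qnz[OF h h]])
    then show ?thesis
      unfolding has_field_derivative_iff
    proof (rule Lim_transform_eventually)
      show "\<forall>\<^sub>F x in at h. - ((F x (m h) - F h (m h)) / (x - h)) / Q x (m x) (m h) = (m x - m h) / (x - h)"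
        using near[OF h]
      proof eventually_elim
        case (elim x)
        have "(m x - m h) * Q x (m x) (m h) = - F x (m h)"
          using elim m[OF h] by (intro key(2)) auto
        then have "m x - m h = - F x (m h) / Q x (m x) (m h)"
          using Qnz[OF elim h] by (simp add: field_simps)
        then show ?case using m[OF h] by simp
      qed
    qed
  qed
  obtain \<phi> where \<phi>: "smooth \<phi>" "\<And>x. \<bar>\<phi> x\<bar> < \<delta>" "\<And>x. \<bar>x\<bar> \<le> \<delta> / 2 \<Longrightarrow> \<phi> x = x"
    using smooth_cutoff[OF \<delta>(1)] by blast
  obtain \<phi>' where \<phi>': "\<And>x. (\<phi> has_vector_derivative \<phi>' x) (at x)" "smooth \<phi>'"
    using smooth_has_derivative[OF \<phi>(1)] by blast
  define \<mu> where "\<mu> h = m (\<phi> h)" for h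
  have \<mu>der: "(\<mu> has_real_derivative (- F' (\<phi> h) (\<mu> h) / Q (\<phi> h) (\<mu> h) (\<mu> h)) * \<phi>' h) (at h)" for h
    unfolding \<mu>_def
    using DERIV_chain2[of m _ \<phi> h, OF mder[OF \<phi>(2)]] \<phi>'(1)[of h]
    by (simp add: has_real_derivative_iff_has_vector_derivative[symmetric])
  \<comment> \<open>In its own derivative \<open>\<mu>\<close> occurs only as an argument of
    \<open>F'\<close> and \<open>Q\<close>, so one level of differentiability yields the
    next.\<close>
  have "ndiff n \<mu>" for n
  proof (induction n)
    case (Suc n)
    have "ndiff n \<phi>" "ndiff n \<phi>'" using \<phi>(1) \<phi>'(2) by (simp_all add: smooth_iff_ndiff)
    note F5 = F(5)[OF this(1) Suc] and \<phi>n = this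
    have "Q (\<phi> h) (\<mu> h) (\<mu> h) \<noteq> 0" for h
      unfolding \<mu>_def by (intro Qnz \<phi>(2))
    then have "ndiff n (\<lambda>h. (- F' (\<phi> h) (\<mu> h) / Q (\<phi> h) (\<mu> h) (\<mu> h)) * \<phi>' h)"
      using F5 \<phi>n by (intro ndiff_mult ndiff_divide ndiff_minus) auto
    from ndiff_Suc_realI[OF \<mu>der this] show ?case .
  qed simp
  then have 1: "smooth \<mu>" by (simp add: smooth_iff_ndiff)
  have near0: "\<forall>\<^sub>F h in nhds 0. \<bar>h\<bar> < \<delta> / 2"
    using \<delta> by (intro order_tendstoD(2)[of abs 0] tendsto_rabs_zero filterlim_ident) simp
  have 2: "\<mu> 0 = z0" using \<phi>(3)[of 0] \<delta> m0 by (simp add: \<mu>_def)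
  have 3: "\<forall>\<^sub>F h in nhds 0. F h (\<mu> h) = 0"
    using near0 by eventually_elim (use \<phi>(3) m \<delta> in \<open>auto simp: \<mu>_def\<close>)
  have 4: "(\<lambda>h. \<mu> h - \<sigma> h) \<in> O[at 0](\<lambda>h. F h (\<sigma> h))" if "(\<sigma> \<longlongrightarrow> z0) (at 0)" for \<sigma>
  proof (rule bigoI[of _ "\<bar>2 / c\<bar>"])
    have "\<forall>\<^sub>F h in at 0. \<bar>\<sigma> h - z0\<bar> < r"
      using tendstoD[OF that r] by (simp add: dist_real_def)
    moreover have "\<forall>\<^sub>F h in at 0. \<bar>h\<bar> < \<delta> / 2"
      using near0 by (simp add: eventually_at_filter eventually_mono)
    ultimately show "\<forall>\<^sub>F h in at 0. norm (\<mu> h - \<sigma> h) \<le> \<bar>2 / c\<bar> * norm (F h (\<sigma> h))"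
    proof eventually_elim
      case (elim h)
      then show ?case using key(1)[of h "\<sigma> h"] \<phi>(3)[of h] by (simp add: \<mu>_def)
    qed
  qed
  show ?thesis by (rule that[OF 1 2 3 4])
qed

section \<open>Real and complex matrices\<close>

lemma matrix_add_rdistrib: "(A + B) ** C = A ** C + B ** C"
  for A B :: "'a::semiring_1^'n^'m"
  by (simp add: vec_eq_iff matrix_matrix_mult_def distrib_right sum.distrib)

lemma scaleR_matrix_mult: "(c *\<^sub>R A) ** B = c *\<^sub>R (A ** B)"
  for A :: "'a::real_algebra_1^'n^'m"
  by (simp add: vec_eq_iff matrix_matrix_mult_def scaleR_sum_right)

lemma matrix_scaleR_mult: "A ** (c *\<^sub>R B) = c *\<^sub>R (A ** B)"
  for A :: "'a::real_algebra_1^'n^'m"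
  by (simp add: vec_eq_iff matrix_matrix_mult_def scaleR_sum_right)

lemma matrix_inv_inverse:
  fixes A :: "'a::semiring_1^'n^'m"
  assumes "invertible A"
  shows "A ** matrix_inv A = mat 1" "matrix_inv A ** A = mat 1"
  using someI_ex[OF assms[unfolded invertible_def]] by (simp_all add: matrix_inv_def)

definition diag_matrix :: "('n \<Rightarrow> 'a::zero) \<Rightarrow> 'a^'n^'n" where
  "diag_matrix d = (\<chi> i j. if i = j then d i else 0)"

lemma is_diagonal_diag_matrix: "is_diagonal (diag_matrix d)"
  by (simp add: is_diagonal_def diag_matrix_def)

lemma diag_matrix_nth: "diag_matrix d $ i $ j = (if i = j then d i else 0)"
  by (simp add: diag_matrix_def)

lemma mult_diag_matrix_nth:
  fixes A :: "'a::semiring_1^'n^'m"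
  shows "(A ** diag_matrix d) $ i $ j = A $ i $ j * d j"
  by (simp add: matrix_matrix_mult_def diag_matrix_def if_distrib cong: if_cong)

lemma diag_matrix_mult_nth:
  fixes A :: "'a::semiring_1^'m^'n"
  shows "(diag_matrix d ** A) $ i $ j = d i * A $ i $ j"
  by (simp add: matrix_matrix_mult_def diag_matrix_def if_distrib[of "\<lambda>x. x * _"] cong: if_cong)

lemma diag_matrix_mult: "diag_matrix d ** diag_matrix e = diag_matrix (\<lambda>i. d i * e i :: 'a::semiring_1)"
  by (simp add: vec_eq_iff mult_diag_matrix_nth) (simp add: diag_matrix_nth)

lemma diag_matrix_one: "diag_matrix (\<lambda>i. 1) = mat 1"
  by (simp add: diag_matrix_def mat_def)

section \<open>Exponentials of diagonalisable matrices\<close>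

lemma matrix_power_conj_diag:
  assumes "B ** A = mat 1" "A ** B = mat 1"
  shows "matrix_power (A ** diag_matrix z ** B) k = A ** diag_matrix (\<lambda>i. z i ^ k) ** B"
proof (induction k)
  case 0
  show ?case using assms by (simp add: matrix_power_def diag_matrix_one)
next
  case (Suc k)
  have "matrix_power (A ** diag_matrix z ** B) (Suc k) =
      A ** diag_matrix z ** (B ** A) ** diag_matrix (\<lambda>i. z i ^ k) ** B"
    using Suc unfolding matrix_power_def by (simp add: matrix_mul_assoc)
  also have "\<dots> = A ** (diag_matrix z ** diag_matrix (\<lambda>i. z i ^ k)) ** B"
    using assms by (simp add: matrix_mul_assoc)
  finally show ?case by (simp add: diag_matrix_mult)
qed

text \<open>Convergence is checked entry by entry, where the series is a finite linear combination
  of scalar exponential series.\<close>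

lemma matrix_exp_conj_diag:
  assumes "B ** A = mat 1" "A ** B = mat 1"
  shows "matrix_exp (A ** diag_matrix z ** B) = A ** diag_matrix (\<lambda>i. exp (z i)) ** B"
proof -
  have nth: "(A ** diag_matrix w ** B) $ i $ j = (\<Sum>l\<in>UNIV. A $ i $ l * w l * B $ l $ j)" for w i j
    unfolding matrix_matrix_mult_def[of "A ** diag_matrix w"] by (simp add: mult_diag_matrix_nth)
  have "(\<lambda>k. (A ** diag_matrix (\<lambda>i. z i ^ k) ** B) /\<^sub>R fact k) sums (A ** diag_matrix (\<lambda>i. exp (z i)) ** B)"
    unfolding sums_def
  proof (intro vec_tendstoI)
    fix i j
    have "(\<lambda>k. \<Sum>l\<in>UNIV. A $ i $ l * (z l ^ k /\<^sub>R fact k) * B $ l $ j) sums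
        (\<Sum>l\<in>UNIV. A $ i $ l * exp (z l) * B $ l $ j)"
      by (intro sums_sum sums_mult2 sums_mult exp_converges)
    then show "(\<lambda>n. (\<Sum>k<n. (A ** diag_matrix (\<lambda>i. z i ^ k) ** B) /\<^sub>R fact k) $ i $ j) \<longlonglongrightarrow>
        (A ** diag_matrix (\<lambda>i. exp (z i)) ** B) $ i $ j"
      by (simp add: sums_def nth sum_component scaleR_sum_right)
  qed
  then show ?thesis
    unfolding matrix_exp_def matrix_power_conj_diag[OF assms] by (simp add: sums_iff)
qed

section \<open>Complexification, characteristic polynomials and diagonalisation\<close>

lemma complexify_nth: "complexify A $ i $ j = of_real (A $ i $ j)"
  by (simp add: complexify_def map_matrix_def)

lemma complexify_mult: "complexify (A ** B) = complexify A ** complexify B"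
  by (simp add: vec_eq_iff complexify_nth matrix_matrix_mult_def)

lemma complexify_mat: "complexify (mat c) = mat (of_real c)"
  by (simp add: vec_eq_iff complexify_nth mat_def)

lemma complexify_diff: "complexify (A - B) = complexify A - complexify B"
  by (simp add: vec_eq_iff complexify_nth)

lemma complexify_diag_matrix: "complexify (diag_matrix d) = diag_matrix (\<lambda>i. of_real (d i))"
  by (simp add: vec_eq_iff complexify_nth diag_matrix_nth)

lemma det_complexify: "det (complexify A) = of_real (det A)"
  by (simp add: det_def complexify_nth)

lemma poly_charpoly: "poly (charpoly A) z = det (mat z - A)"
proof -
  have "poly ((mat [:0, 1:] - map_matrix (\<lambda>a. [:a:]) A) $ i $ j) z = (mat z - A) $ i $ j" for i j
    by (simp add: mat_def map_matrix_def)
  then show ?thesis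
    unfolding charpoly_def det_def by (simp add: poly_sum poly_prod del: vector_minus_component)
qed

text \<open>Only the identity permutation reaches this degree: any other one meets a constant
  off-diagonal entry. The characteristic polynomial is therefore nonzero, with degree at least the
  dimension.\<close>

lemma coeff_charpoly_card: "coeff (charpoly (A :: 'a::idom^'n^'n)) CARD('n) = 1"
proof -
  define M where "M = mat [:0, 1:] - map_matrix (\<lambda>a. [:a:]) A"
  have M: "M $ i $ j = (if i = j then [:- (A $ i $ j), 1:] else [:- (A $ i $ j):])" for i j
    by (simp add: M_def mat_def map_matrix_def)
  have other: "coeff (\<Prod>i\<in>UNIV. M $ i $ p i) CARD('n) = 0" if "p \<noteq> id" for p
  proof -
    obtain k where k: "p k \<noteq> k" using \<open>p \<noteq> id\<close> by (auto simp: fun_eq_iff)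
    have "degree (\<Prod>i\<in>UNIV. M $ i $ p i) \<le> (\<Sum>i\<in>UNIV. degree (M $ i $ p i))"
      using degree_prod_sum_le[of UNIV "\<lambda>i. M $ i $ p i"] by (simp add: o_def)
    also have "\<dots> < (\<Sum>i\<in>(UNIV::'n set). 1)"
      by (rule sum_strict_mono_ex1) (use k not_sym[OF k] in \<open>auto simp: M\<close>)
    finally show ?thesis by (intro coeff_eq_0) simp
  qed
  have "lead_coeff (\<Prod>i\<in>UNIV. M $ i $ i) = 1"
    by (simp add: M lead_coeff_prod)
  moreover have "degree (\<Prod>i\<in>UNIV. M $ i $ i) = CARD('n)"
    by (simp add: M degree_prod_eq_sum_degree)
  ultimately have diag: "coeff (\<Prod>i\<in>UNIV. M $ i $ i) CARD('n) = 1" by simp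
  have "coeff (charpoly A) CARD('n) =
      (\<Sum>p\<in>{p. p permutes (UNIV :: 'n set)}. of_int (sign p) * coeff (\<Prod>i\<in>UNIV. M $ i $ p i) CARD('n))"
    unfolding charpoly_def det_def coeff_sum M_def[symmetric]
    by (intro sum.cong refl) (simp add: of_int_poly)
  also have "\<dots> = (\<Sum>p\<in>{p. p permutes (UNIV :: 'n set)}. if p = id then 1 else 0)"
    by (intro sum.cong refl) (use other diag in \<open>auto simp: sign_id\<close>)
  also have "\<dots> = 1"
    by (simp add: finite_permutations permutes_id)
  finally show ?thesis .
qed

lemma det_eq_0_iff_kernel: "det (A :: 'a::field^'n^'n) = 0 \<longleftrightarrow> (\<exists>v. v \<noteq> 0 \<and> A *v v = 0)"
  using invertible_det_nz[of A] matrix_left_invertible_ker[of A]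
  by (auto simp: invertible_left_inverse)

lemma eigenvalue_iff_det: "eigenvalue A c \<longleftrightarrow> det (mat c - A) = 0"
proof -
  have "mat c *v v = c *s v" for v
    by (simp add: vec_eq_iff matrix_vector_mult_def mat_def if_distrib[of "\<lambda>x. x * _"] cong: if_cong)
  then have "(mat c - A) *v v = c *s v - A *v v" for v
    by (simp add: matrix_vector_mult_diff_rdistrib)
  then show ?thesis
    unfolding det_eq_0_iff_kernel eigenvalue_def by auto
qed

text \<open>The dimension is at most the degree, which over the complex numbers is the sum of the
  orders of the roots. All orders are one, so there are enough distinct roots to label them
  injectively by the index type.\<close>

lemma real_simple_spectrum:
  fixes H :: "real^'n^'n"
  assumes "\<And>c. eigenvalue (complexify H) c \<Longrightarrow> c \<in> \<real> \<and> simple_eigenvalue (complexify H) c"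
  obtains \<nu> :: "'n \<Rightarrow> real" where "inj \<nu>" "\<And>j. det (mat (\<nu> j) - H) = 0"
proof -
  let ?p = "charpoly (complexify H)"
  let ?R = "{c. poly ?p c = 0}"
  have root: "poly ?p c = 0 \<longleftrightarrow> eigenvalue (complexify H) c" for c
    by (simp add: poly_charpoly eigenvalue_iff_det)
  have p0: "?p \<noteq> 0" using coeff_charpoly_card[of "complexify H"] by auto
  then have fin: "finite ?R" by (rule poly_roots_finite)
  have "CARD('n) \<le> degree ?p"
    using coeff_charpoly_card[of "complexify H"] by (intro le_degree) simp
  also have "degree ?p = size (proots ?p)" by (simp add: size_proots_complex)
  also have "\<dots> = (\<Sum>c\<in>?R. order c ?p)"
    using p0 by (simp add: size_multiset_overloaded_eq)
  also have "\<dots> = (\<Sum>c\<in>?R. 1)"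
    by (intro sum.cong refl) (use assms root in \<open>auto simp: simple_eigenvalue_def\<close>)
  finally have "card (UNIV :: 'n set) \<le> card ?R" by simp
  then obtain f :: "'n \<Rightarrow> complex" where f: "inj f" "range f \<subseteq> ?R"
    using card_le_inj[of "UNIV :: 'n set" ?R] fin by auto
  have f': "of_real (Re (f j)) = f j" for j
    using f(2) assms root by (metis (mono_tags, lifting) mem_Collect_eq of_real_Re rangeI subsetD)
  have "inj (\<lambda>j. Re (f j))"
    using f(1) f' by (metis (mono_tags, lifting) inj_on_def)
  moreover have "det (mat (Re (f j)) - H) = 0" for j
  proof -
    have "complex_of_real (det (mat (Re (f j)) - H)) = det (mat (f j) - complexify H)"
      by (simp add: det_complexify[symmetric] complexify_diff complexify_mat f')
    also have "\<dots> = 0" using f(2) by (auto simp: poly_charpoly)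
    finally show ?thesis by simp
  qed
  ultimately show ?thesis by (rule that)
qed

text \<open>The columns of \<open>P\<close> are eigenvectors. Their independence is shown on
  coordinates: the kernel of \<open>P\<close> is stable under the diagonal maps
  \<open>diag_matrix \<nu> - l\<close>, and products of these isolate single coordinates.\<close>

lemma diagonalizable:
  fixes H :: "'a::field^'n^'n"
  assumes inj: "inj \<nu>" and det: "\<And>j. det (mat (\<nu> j) - H) = 0"
  obtains P :: "'a^'n^'n" where "invertible P" "H ** P = P ** diag_matrix \<nu>"
proof -
  have "\<exists>v. v \<noteq> 0 \<and> H *v v = \<nu> j *s v" for j
    using det[of j] unfolding eigenvalue_iff_det[symmetric] eigenvalue_def .
  then obtain v where v: "\<And>j. v j \<noteq> 0" "\<And>j. H *v v j = \<nu> j *s v j"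
    by metis
  define P :: "'a^'n^'n" where "P = (\<chi> i j. v j $ i)"
  have HP: "H ** P = P ** diag_matrix \<nu>"
  proof -
    have "(H ** P) $ i $ j = (H *v v j) $ i" for i j
      by (simp add: matrix_matrix_mult_def matrix_vector_mult_def P_def)
    then show ?thesis
      by (simp add: vec_eq_iff v(2) mult_diag_matrix_nth) (simp add: P_def mult.commute)
  qed
  \<comment> \<open>Since \<open>P ** diag_matrix \<nu> = H ** P\<close>, a kernel vector of
    \<open>P\<close> stays one after multiplication by \<open>diag_matrix \<nu>\<close>.\<close>
  have shift: "P *v (\<chi> j. (\<nu> j - l) * y $ j) = 0" if y: "P *v y = 0" for l y
  proof -
    have "(\<chi> j. (\<nu> j - l) * y $ j) = diag_matrix \<nu> *v y - l *s y"
      by (simp add: vec_eq_iff matrix_vector_mult_def diag_matrix_nth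
          if_distrib[of "\<lambda>x. x * _"] left_diff_distrib cong: if_cong)
    then have "P *v (\<chi> j. (\<nu> j - l) * y $ j) = (P ** diag_matrix \<nu>) *v y - l *s (P *v y)"
      by (simp add: matrix_vector_mult_diff_distrib vector_scalar_commute matrix_vector_mul_assoc)
    also have "\<dots> = 0"
      unfolding HP[symmetric] matrix_vector_mul_assoc[symmetric] y by simp
    finally show ?thesis .
  qed
  have "x = 0" if x: "P *v x = 0" for x
  proof -
    have kernel: "P *v (\<chi> j. (\<Prod>k\<in>A. \<nu> j - \<nu> k) * x $ j) = 0" if "finite A" for A
      using that
    proof (induction A rule: finite_induct)
      case empty
      then show ?case using x by simp
    next
      case (insert k A)
      from shift[OF insert.IH, of "\<nu> k"] show ?case
        using insert.hyps by (simp add: mult.assoc)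
    qed
    have "x $ i = 0" for i
    proof -
      \<comment> \<open>The product over all \<open>k \<noteq> i\<close> kills every coordinate but
        the \<open>i\<close>-th, which gets multiplied by \<open>c\<close>, nonzero because
        \<open>\<nu>\<close> is injective.\<close>
      define c where "c = (\<Prod>k\<in>UNIV - {i}. \<nu> i - \<nu> k)"
      have c: "c \<noteq> 0" using inj by (auto simp: c_def inj_eq)
      have "(\<Prod>k\<in>UNIV - {i}. \<nu> j - \<nu> k) = 0" if "j \<noteq> i" for j
        using that by (intro prod_zero) auto
      then have "(\<chi> j. (\<Prod>k\<in>UNIV - {i}. \<nu> j - \<nu> k) * x $ j) = (c * x $ i) *s axis i 1"
        by (auto simp: vec_eq_iff axis_def c_def)
      then have "(c * x $ i) *s (P *v axis i 1) = 0"
        using kernel[of "UNIV - {i}"] by (simp add: vector_scalar_commute)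
      moreover have "P *v axis i 1 = v i"
        by (simp add: vec_eq_iff P_def matrix_vector_mult_def axis_def if_distrib cong: if_cong)
      ultimately have "(c * x $ i) *s v i = 0" by simp
      then show ?thesis using c v(1)[of i] by (auto simp: vector_mul_eq_0)
    qed
    then show ?thesis by (simp add: vec_eq_iff)
  qed
  then have "det P \<noteq> 0" unfolding det_eq_0_iff_kernel by blast
  then have "invertible P" by (simp add: invertible_det_nz)
  then show ?thesis using HP that by blast
qed

text \<open>The determinants are the cofactors of row \<open>j\<close>. By linearity the sum is the
  determinant of \<open>M\<close> with row \<open>j\<close> replaced by row \<open>r\<close>: either
  \<open>det M\<close> or a determinant with two equal rows. This gives kernel vectors that are
  polynomial in the entries, hence smooth.\<close>

lemma cofactor_kernel:
  fixes M :: "'a::field^'n^'n"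
  assumes "det M = 0"
  shows "(\<Sum>i\<in>UNIV. M $ r $ i * det (\<chi> s. if s = j then axis i 1 else M $ s)) = 0"
proof -
  have "(\<Sum>i\<in>UNIV. M $ r $ i * det (\<chi> s. if s = j then axis i 1 else M $ s)) =
      (\<Sum>i\<in>UNIV. det (\<chi> s. if s = j then M $ r $ i *s axis i 1 else M $ s))"
    by (simp add: det_row_mul)
  also have "\<dots> = det (\<chi> s. if s = j then (\<Sum>i\<in>UNIV. M $ r $ i *s axis i 1) else M $ s)"
    by (simp add: det_linear_row_sum)
  also have "\<dots> = det (\<chi> s. if s = j then M $ r else M $ s)"
    by (simp only: basis_expansion)
  also have "\<dots> = 0"
  proof (cases "r = j")
    case True
    then have "(\<chi> s. if s = j then M $ r else M $ s) = M" by (simp add: vec_eq_iff)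
    then show ?thesis using assms by simp
  next
    case False
    then show ?thesis by (intro det_identical_rows[of r j]) (simp_all add: row_def vec_eq_iff)
  qed
  finally show ?thesis .
qed

section \<open>Smooth eigenvalues and eigenvectors\<close>

lemma eventually_at_if_nhds: "\<forall>\<^sub>F x in nhds a. P x \<Longrightarrow> \<forall>\<^sub>F x in at a. P x"
  by (auto simp: eventually_at_filter elim: eventually_mono)

lemma bigo_power_tendsto_0:
  fixes f :: "real \<Rightarrow> real"
  assumes "f \<in> O[at 0](\<lambda>h. h ^ p)" "p \<ge> 1"
  shows "(f \<longlongrightarrow> 0) (at 0)"
proof -
  obtain K where K: "\<forall>\<^sub>F h in at 0. norm (f h) \<le> K * norm (h ^ p)"
    using assms(1) by (elim landau_o.bigE)
  have "((\<lambda>h::real. h ^ p) \<longlongrightarrow> 0 ^ p) (at 0)"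
    by (intro tendsto_intros)
  then have "((\<lambda>h::real. K * norm (h ^ p)) \<longlongrightarrow> K * norm (0::real)) (at 0)"
    using assms(2) by (intro tendsto_mult tendsto_const tendsto_norm) (simp add: power_0_left)
  then show ?thesis
    by (intro Lim_null_comparison[OF K]) simp
qed

text \<open>The filter \<open>at 0\<close> leaves out the origin, so an asymptotic estimate
  determines the value there only through continuity.\<close>

lemma bigo_value_at_0:
  fixes g :: "real \<Rightarrow> real"
  assumes "isCont g 0" "(\<lambda>h. g h - s h) \<in> O[at 0](\<lambda>h. h ^ p)" "p \<ge> 1" "(s \<longlongrightarrow> c) (at 0)"
  shows "g 0 = c"
proof (rule tendsto_unique[of "at 0"])
  show "(g \<longlongrightarrow> g 0) (at 0)" using assms(1) by (simp add: isCont_def)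
  show "(g \<longlongrightarrow> c) (at 0)"
    using tendsto_add[OF bigo_power_tendsto_0[OF assms(2,3)] assms(4)] by simp
qed simp

lemma tendsto_imp_bigo_1:
  fixes f :: "real \<Rightarrow> real"
  assumes "(f \<longlongrightarrow> a) F"
  shows "f \<in> O[F](\<lambda>_. 1)"
  using assms by (intro bigoI_tendsto[of _ _ a]) auto

lemma bigo_cancel_factor:
  fixes f g :: "real \<Rightarrow> real"
  assumes "(\<lambda>h. f h * g h) \<in> O[F](k)" "(f \<longlongrightarrow> a) F" "a \<noteq> 0"
  shows "g \<in> O[F](k)"
proof -
  have "(\<lambda>h. inverse (f h)) \<in> O[F](\<lambda>_. 1)"
    using tendsto_inverse[OF assms(2,3)] by (intro tendsto_imp_bigo_1)
  from landau_o.big.mult[OF this assms(1)]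
  have "(\<lambda>h. inverse (f h) * (f h * g h)) \<in> O[F](k)" by simp
  moreover have "\<forall>\<^sub>F h in F. inverse (f h) * (f h * g h) = g h"
    using tendsto_imp_eventually_ne[OF assms(2,3)] by eventually_elim simp
  ultimately show ?thesis by (subst (asm) landau_o.big.in_cong)
qed

text \<open>Division by \<open>h\<close> costs one power; this is how the order \<open>p + 1\<close>
  of consistency becomes the order \<open>p\<close> of the factors.\<close>

lemma bigo_cancel_var:
  fixes f :: "real \<Rightarrow> real"
  assumes "(\<lambda>h. h * f h) \<in> O[at 0](\<lambda>h. h ^ Suc p)"
  shows "f \<in> O[at 0](\<lambda>h. h ^ p)"
proof -
  obtain K where "\<forall>\<^sub>F h in at 0. norm (h * f h) \<le> K * norm (h ^ Suc p)"
    using assms by (elim landau_o.bigE)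
  moreover have "\<forall>\<^sub>F h::real in at 0. h \<noteq> 0" by (simp add: eventually_at_filter)
  ultimately have "\<forall>\<^sub>F h in at 0. norm (f h) \<le> K * norm (h ^ p)"
    by eventually_elim (simp add: abs_mult mult.left_commute)
  then show ?thesis by (rule bigoI)
qed

section \<open>Determinants and eigenpairs of smooth matrix families\<close>

lemma det_row_bigo:
  fixes M :: "real \<Rightarrow> real^'n^'n"
  assumes "\<And>k. (\<lambda>h. M h $ j $ k) \<in> O[F](g)" "\<And>i k. (\<lambda>h. M h $ i $ k) \<in> O[F](\<lambda>_. 1)"
  shows "(\<lambda>h. det (M h)) \<in> O[F](g)"
proof -
  have prod1: "(\<lambda>h. \<Prod>i\<in>I. M h $ i $ p i) \<in> O[F](\<lambda>_. 1)" for I p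
    by (intro landau_o.big_prod_in_1 assms(2))
  have "(\<lambda>h. of_int (sign p) * (\<Prod>i\<in>UNIV. M h $ i $ p i)) \<in> O[F](g)" for p
  proof -
    \<comment> \<open>Every Leibniz term contains exactly one entry of row \<open>j\<close>, which
      supplies \<open>g\<close>; the other factors stay bounded.\<close>
    have "(\<Prod>i\<in>UNIV. M h $ i $ p i) = M h $ j $ p j * (\<Prod>i\<in>UNIV - {j}. M h $ i $ p i)" for h
      by (rule prod.remove) auto
    then show ?thesis
      using landau_o.big.mult[OF assms(1)[of "p j"] prod1[of p "UNIV - {j}"]] by simp
  qed
  then show ?thesis unfolding det_def by (rule big_sum_in_bigo)
qed

lemma ndiff_det:
  fixes M :: "real \<Rightarrow> real^'n^'n"
  assumes "\<And>i j. ndiff n (\<lambda>h. M h $ i $ j)"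
  shows "ndiff n (\<lambda>h. det (M h))"
  unfolding det_def by (intro ndiff_sum ndiff_mult ndiff_prod ndiff_const assms)

text \<open>At the origin \<open>C\<close> is diagonal with distinct entries \<open>\<nu>\<close>,
  so each \<open>\<nu> j\<close> is a simple root of the characteristic polynomial and continues
  smoothly. The diagonal approximation \<open>\<sigma>\<close> enters as a family of approximate
  roots.\<close>

lemma smooth_eigenbasis:
  fixes C :: "real \<Rightarrow> real^'n^'n" and \<nu> :: "'n \<Rightarrow> real" and \<sigma> :: "'n \<Rightarrow> real \<Rightarrow> real"
  assumes smC: "\<And>i j. smooth (\<lambda>h. C h $ i $ j)" and inj: "inj \<nu>" and p: "p \<ge> 1"
    and \<sigma>: "\<And>j. (\<sigma> j \<longlongrightarrow> \<nu> j) (at 0)"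
    and C\<sigma>: "\<And>i j. (\<lambda>h. C h $ i $ j - (if i = j then \<sigma> i h else 0)) \<in> O[at 0](\<lambda>h. h ^ p)"
  obtains \<mu> :: "'n \<Rightarrow> real \<Rightarrow> real" and v :: "'n \<Rightarrow> 'n \<Rightarrow> real \<Rightarrow> real"
  where "\<And>j. smooth (\<mu> j)" "\<And>j. \<mu> j 0 = \<nu> j" "\<And>j. (\<lambda>h. \<mu> j h - \<sigma> j h) \<in> O[at 0](\<lambda>h. h ^ p)"
    "\<And>i j. smooth (v i j)" "\<And>j. v j j 0 \<noteq> 0"
    "\<And>i j. i \<noteq> j \<Longrightarrow> v i j \<in> O[at 0](\<lambda>h. h ^ p)"
    "\<And>r j. \<forall>\<^sub>F h in nhds 0. (\<Sum>i\<in>UNIV. C h $ r $ i * v i j h) = \<mu> j h * v r j h"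
proof -
  have Clim: "((\<lambda>h. C h $ i $ j) \<longlongrightarrow> (if i = j then \<nu> i else 0)) (at 0)" for i j
  proof -
    have "((\<lambda>h. if i = j then \<sigma> i h else 0) \<longlongrightarrow> (if i = j then \<nu> i else 0)) (at 0)"
      using \<sigma> by auto
    from tendsto_add[OF bigo_power_tendsto_0[OF C\<sigma>[of i j] p] this] show ?thesis by simp
  qed
  have C0: "C 0 $ i $ j = (if i = j then \<nu> i else 0)" for i j
    using smooth_imp_continuous[OF smC[of i j], of 0] Clim[of i j] unfolding isCont_def
    by (intro tendsto_unique[of "at 0"]) auto
  define F where "F h z = det (mat z - C h)" for h z
  have adm: "admissible F" unfolding F_def by (rule admissible_det[OF smC])
  have F0: "F 0 z = (\<Prod>k\<in>UNIV. z - \<nu> k)" for z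
    unfolding F_def by (subst det_diagonal) (auto simp: mat_def C0)
  \<comment> \<open>The derivative of \<open>F 0\<close> at its root \<open>\<nu> j\<close>;
    distinctness of the \<open>\<nu>\<close> keeps it away from zero.\<close>
  define c where "c j = (\<Prod>k\<in>UNIV - {j}. \<nu> j - \<nu> k)" for j
  have c: "c j \<noteq> 0" for j using inj by (auto simp: c_def inj_eq)
  have "\<exists>\<mu>. smooth \<mu> \<and> \<mu> 0 = \<nu> j \<and> (\<forall>\<^sub>F h in nhds 0. F h (\<mu> h) = 0) \<and>
      (\<lambda>h. \<mu> h - \<sigma> j h) \<in> O[at 0](\<lambda>h. F h (\<sigma> j h))" for j
  proof -
    have fac: "F 0 z = (z - \<nu> j) * (\<Prod>k\<in>UNIV - {j}. z - \<nu> k)" for z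
      unfolding F0 by (rule prod.remove) auto
    have "((\<lambda>z. \<Prod>k\<in>UNIV - {j}. z - \<nu> k) \<longlongrightarrow> c j) (at (\<nu> j))"
      unfolding c_def by (intro tendsto_intros)
    then have der: "(F 0 has_real_derivative c j) (at (\<nu> j))"
      unfolding has_field_derivative_iff
      by (rule Lim_transform_eventually) (auto simp: eventually_at_filter fac)
    have "F 0 (\<nu> j) = 0" by (simp add: fac)
    from admissible_implicit[OF adm this der c] show ?thesis
      using \<sigma>[of j] by blast
  qed
  then obtain \<mu> where \<mu>: "\<And>j. smooth (\<mu> j)" "\<And>j. \<mu> j 0 = \<nu> j"
    "\<And>j. \<forall>\<^sub>F h in nhds 0. F h (\<mu> j h) = 0"
    "\<And>j. (\<lambda>h. \<mu> j h - \<sigma> j h) \<in> O[at 0](\<lambda>h. F h (\<sigma> j h))"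
    by metis
  have O1: "(\<lambda>h. (mat (\<sigma> j h) - C h) $ i $ k) \<in> O[at 0](\<lambda>_. 1)" for i j k
  proof (rule tendsto_imp_bigo_1)
    have "((\<lambda>h. if i = k then \<sigma> j h else 0) \<longlongrightarrow> (if i = k then \<nu> j else 0)) (at 0)"
      using \<sigma>[of j] by auto
    from tendsto_diff[OF this Clim[of i k]]
    show "((\<lambda>h. (mat (\<sigma> j h) - C h) $ i $ k) \<longlongrightarrow>
        (if i = k then \<nu> j else 0) - (if i = k then \<nu> i else 0)) (at 0)"
      by (simp add: mat_def)
  qed
  have Oj: "(\<lambda>h. (mat (\<sigma> j h) - C h) $ j $ k) \<in> O[at 0](\<lambda>h. h ^ p)" for j k
  proof -
    have "(\<lambda>h. - (C h $ j $ k - (if j = k then \<sigma> j h else 0))) \<in> O[at 0](\<lambda>h. h ^ p)"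
      using C\<sigma>[of j k] by (simp only: landau_o.big.uminus_in_iff)
    then show ?thesis by (simp add: mat_def)
  qed
  \<comment> \<open>The residual \<open>F h (\<sigma> j h)\<close> is a determinant whose row
    \<open>j\<close> is small, diagonal entry included, while the other rows are bounded.\<close>
  have \<mu>\<sigma>: "(\<lambda>h. \<mu> j h - \<sigma> j h) \<in> O[at 0](\<lambda>h. h ^ p)" for j
    using \<mu>(4)[of j] det_row_bigo[OF Oj O1] unfolding F_def by (rule landau_o.big_trans)
  \<comment> \<open>Component \<open>i\<close> of the eigenvector for \<open>\<mu> j\<close>: a
    cofactor of row \<open>j\<close> of the singular matrix. Fixing row \<open>j\<close> makes the
    \<open>j\<close>-th component nonzero at the origin.\<close>
  define v where "v i j h = det (\<chi> s. if s = j then axis i 1 else (mat (\<mu> j h) - C h) $ s)" for i j h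
  have smv: "smooth (v i j)" for i j
    unfolding v_def smooth_iff_ndiff
  proof (intro allI ndiff_det)
    fix n r s
    have "ndiff n (\<lambda>h. C h $ r $ s)" "ndiff n (\<mu> j)"
      using smC \<mu>(1) by (simp_all add: smooth_iff_ndiff)
    then show "ndiff n (\<lambda>h. (\<chi> s. if s = j then axis i 1 else (mat (\<mu> j h) - C h) $ s) $ r $ s)"
      by (cases "r = j"; cases "r = s") (simp_all add: mat_def ndiff_const ndiff_diff ndiff_minus)
  qed
  have "v j j 0 = c j" for j
  proof -
    have "v j j 0 = (\<Prod>k\<in>UNIV. if k = j then 1 else \<nu> j - \<nu> k)"
      unfolding v_def by (subst det_diagonal) (auto simp: mat_def axis_def C0 \<mu>(2) intro!: prod.cong)
    also have "\<dots> = c j"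
      unfolding c_def by (subst prod.remove[of _ j]) (auto intro!: prod.cong)
    finally show ?thesis .
  qed
  then have v0: "v j j 0 \<noteq> 0" for j using c by simp
  have ker: "\<forall>\<^sub>F h in nhds 0. (\<Sum>i\<in>UNIV. C h $ r $ i * v i j h) = \<mu> j h * v r j h" for r j
    using \<mu>(3)[of j]
  proof eventually_elim
    case (elim h)
    then have "(\<Sum>i\<in>UNIV. (mat (\<mu> j h) - C h) $ r $ i * v i j h) = 0"
      unfolding v_def F_def by (rule cofactor_kernel)
    moreover have "(\<Sum>i\<in>UNIV. (mat (\<mu> j h) - C h) $ r $ i * v i j h) =
        (\<Sum>i\<in>UNIV. (if r = i then \<mu> j h * v i j h else 0) - C h $ r $ i * v i j h)"
      by (intro sum.cong refl) (simp add: mat_def left_diff_distrib)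
    ultimately show ?case by (simp add: sum_subtractf)
  qed
  \<comment> \<open>Row \<open>i\<close> of the eigenvector equation expresses
    \<open>(\<mu> j h - C h $ i $ i) * v i j h\<close> through the small off-diagonal entries of
    \<open>C\<close>, and the factor tends to \<open>\<nu> j - \<nu> i\<close>, which is not
    zero.\<close>
  have off: "v i j \<in> O[at 0](\<lambda>h. h ^ p)" if "i \<noteq> j" for i j
  proof -
    have "(\<lambda>h. \<Sum>k\<in>UNIV - {i}. C h $ i $ k * v k j h) \<in> O[at 0](\<lambda>h. h ^ p)"
    proof (rule big_sum_in_bigo)
      fix k assume "k \<in> UNIV - {i}"
      then have "(\<lambda>h. C h $ i $ k) \<in> O[at 0](\<lambda>h. h ^ p)" using C\<sigma>[of i k] by simp
      moreover have "v k j \<in> O[at 0](\<lambda>_. 1)"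
        using smooth_imp_continuous[OF smv[of k j], of 0] unfolding isCont_def by (rule tendsto_imp_bigo_1)
      ultimately show "(\<lambda>h. C h $ i $ k * v k j h) \<in> O[at 0](\<lambda>h. h ^ p)"
        using landau_o.big.mult by fastforce
    qed
    moreover have "\<forall>\<^sub>F h in at 0. (\<Sum>k\<in>UNIV - {i}. C h $ i $ k * v k j h) = (\<mu> j h - C h $ i $ i) * v i j h"
      using eventually_at_if_nhds[OF ker[of i j]]
      by eventually_elim (simp add: sum.remove[of UNIV i] algebra_simps)
    ultimately have "(\<lambda>h. (\<mu> j h - C h $ i $ i) * v i j h) \<in> O[at 0](\<lambda>h. h ^ p)"
      by (subst (asm) landau_o.big.in_cong)
    moreover have "((\<lambda>h. \<mu> j h - C h $ i $ i) \<longlongrightarrow> \<nu> j - \<nu> i) (at 0)"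
      using smooth_imp_continuous[OF \<mu>(1)[of j], of 0] Clim[of i i] \<mu>(2)[of j]
      by (intro tendsto_diff) (auto simp: isCont_def)
    moreover have "\<nu> j - \<nu> i \<noteq> 0" using inj that by (simp add: inj_eq)
    ultimately show ?thesis by (rule bigo_cancel_factor)
  qed
  show ?thesis by (rule that[OF \<mu>(1,2) \<mu>\<sigma> smv v0 off ker])
qed

text \<open>Since \<open>1 < pi / 3\<close>, the cosine is at least one half on the interval from -1
  to 1, and the mean value theorem applies. The estimate recovers angles from their sines.\<close>

lemma abs_diff_le_sin:
  fixes x y :: real
  assumes "\<bar>x\<bar> \<le> 1" "\<bar>y\<bar> \<le> 1"
  shows "\<bar>x - y\<bar> \<le> 2 * \<bar>sin x - sin y\<bar>"
proof -
  have *: "y - x \<le> 2 * (sin y - sin x)" if xy: "x < y" "- 1 \<le> x" "y \<le> 1" for x y :: real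
  proof -
    obtain z where z: "x < z" "z < y" "sin y - sin x = (y - x) * cos z"
      using MVT2[OF xy(1), of sin cos, OF DERIV_sin] by blast
    have "cos (pi / 3) \<le> cos \<bar>z\<bar>"
      using z xy pi_gt3 by (intro cos_monotone_0_pi_le) auto
    then have "cos z \<ge> 1 / 2" by (simp add: cos_60)
    then have "(y - x) * (1 / 2) \<le> (y - x) * cos z"
      using xy by (intro mult_left_mono) auto
    then show ?thesis using z by simp
  qed
  show ?thesis
  proof (cases x y rule: linorder_cases)
    case less
    then have "y - x \<le> 2 * (sin y - sin x)" using assms by (intro *) auto
    then show ?thesis
      using less abs_ge_minus_self[of "sin x - sin y"] by (simp add: abs_of_neg)
  next
    case greater
    then have "x - y \<le> 2 * (sin x - sin y)" using assms by (intro *) auto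
    then show ?thesis
      using greater abs_ge_self[of "sin x - sin y"] by (simp add: abs_of_pos)
  qed simp
qed

text \<open>\<open>Y\<close> vanishes at the origin, where all its eigenvalues coincide, so it is
  \<open>Y / h\<close> that gets diagonalised. \<open>comm\<close> then makes \<open>X\<close>
  diagonal in the same basis, and \<open>sq\<close> determines its eigenvalues up to sign.\<close>

lemma simultaneous_diagonalization:
  fixes X Y :: "real \<Rightarrow> real^'n^'n" and \<nu> :: "'n \<Rightarrow> real"
  assumes smX: "\<And>i j. smooth (\<lambda>h. X h $ i $ j)" and smY: "\<And>i j. smooth (\<lambda>h. Y h $ i $ j)"
    and sq: "\<And>h. X h ** X h + Y h ** Y h = mat 1" and comm: "\<And>h. X h ** Y h = Y h ** X h"
    and inj: "inj \<nu>" and p: "p \<ge> 1"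
    and bX: "\<And>i j. (\<lambda>h. X h $ i $ j - (if i = j then cos (h * \<nu> i) else 0)) \<in> O[at 0](\<lambda>h. h ^ Suc p)"
    and bY: "\<And>i j. (\<lambda>h. Y h $ i $ j - (if i = j then sin (h * \<nu> i) else 0)) \<in> O[at 0](\<lambda>h. h ^ Suc p)"
  obtains V :: "real \<Rightarrow> real^'n^'n" and d :: "'n \<Rightarrow> real \<Rightarrow> real"
  where "\<And>i j. smooth (\<lambda>h. V h $ i $ j)" "\<And>j. smooth (d j)" "\<And>h. invertible (V h)"
    "\<And>i j. (\<lambda>h. V h $ i $ j - V 0 $ i $ j) \<in> O[at 0](\<lambda>h. h ^ p)"
    "\<And>j. (\<lambda>h. d j h - d j 0) \<in> O[at 0](\<lambda>h. h ^ p)"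
    "\<forall>\<^sub>F h in nhds 0. X h ** V h = V h ** diag_matrix (\<lambda>j. cos (h * d j h)) \<and>
       Y h ** V h = V h ** diag_matrix (\<lambda>j. sin (h * d j h))"
proof -
  have sin0: "((\<lambda>h. sin (h * \<nu> i)) \<longlongrightarrow> 0) (at 0)" and cos0: "((\<lambda>h. cos (h * \<nu> i)) \<longlongrightarrow> 1) (at 0)" for i
    using tendsto_sin[OF tendsto_mult_left_zero[OF tendsto_ident_at, of "\<nu> i" UNIV]]
      tendsto_cos[OF tendsto_mult_left_zero[OF tendsto_ident_at, of "\<nu> i" UNIV]] by simp_all
  have sin0': "((\<lambda>h. if i = j then sin (h * \<nu> i) else 0) \<longlongrightarrow> 0) (at 0)" for i j
    using sin0 by (cases "i = j") simp_all
  have cos0': "((\<lambda>h. if i = j then cos (h * \<nu> i) else 0) \<longlongrightarrow> (if i = j then 1 else 0)) (at 0)" for i j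
    using cos0 by (cases "i = j") simp_all
  have Y0: "Y 0 $ i $ j = 0" for i j
    by (rule bigo_value_at_0[OF smooth_imp_continuous[OF smY] bY]) (use sin0' p in auto)
  have X0: "X 0 $ i $ j = (if i = j then 1 else 0)" for i j
    by (rule bigo_value_at_0[OF smooth_imp_continuous[OF smX] bX]) (use cos0' p in auto)
  have "\<exists>g. smooth g \<and> (\<forall>h. Y h $ i $ j = h * g h)" for i j
    using smooth_hadamard[OF smY[of i j] Y0] by blast
  then obtain g where g: "\<And>i j. smooth (g i j)" "\<And>i j h. Y h $ i $ j = h * g i j h"
    by metis
  define C where "C h = (\<chi> i j. g i j h)" for h
  have smC: "smooth (\<lambda>h. C h $ i $ j)" for i j using g(1) by (simp add: C_def)
  have YC: "Y h = h *\<^sub>R C h" for h by (simp add: vec_eq_iff C_def g(2))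
  define \<sigma> where "\<sigma> j h = sin (h * \<nu> j) / h" for j h
  have \<sigma>: "(\<sigma> j \<longlongrightarrow> \<nu> j) (at 0)" for j
  proof -
    have "((\<lambda>h. sin (h * \<nu> j)) has_real_derivative \<nu> j) (at 0)"
      by (auto intro!: derivative_eq_intros)
    then show ?thesis by (simp add: has_field_derivative_iff \<sigma>_def[abs_def])
  qed
  have C\<sigma>: "(\<lambda>h. C h $ i $ j - (if i = j then \<sigma> i h else 0)) \<in> O[at 0](\<lambda>h. h ^ p)" for i j
  proof (rule bigo_cancel_var)
    have "\<forall>\<^sub>F h in at 0. Y h $ i $ j - (if i = j then sin (h * \<nu> i) else 0) =
        h * (C h $ i $ j - (if i = j then \<sigma> i h else 0))"
      by (auto simp: eventually_at_filter YC \<sigma>_def algebra_simps)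
    with bY[of i j] show "(\<lambda>h. h * (C h $ i $ j - (if i = j then \<sigma> i h else 0))) \<in> O[at 0](\<lambda>h. h ^ Suc p)"
      by (subst (asm) landau_o.big.in_cong)
  qed
  obtain \<mu> v where \<mu>: "\<And>j. smooth (\<mu> j)" "\<And>j. \<mu> j 0 = \<nu> j"
      "\<And>j. (\<lambda>h. \<mu> j h - \<sigma> j h) \<in> O[at 0](\<lambda>h. h ^ p)"
    and v: "\<And>i j. smooth (v i j)" "\<And>j. v j j 0 \<noteq> 0"
      "\<And>i j. i \<noteq> j \<Longrightarrow> v i j \<in> O[at 0](\<lambda>h. h ^ p)"
    and ker: "\<And>r j. \<forall>\<^sub>F h in nhds 0. (\<Sum>i\<in>UNIV. C h $ r $ i * v i j h) = \<mu> j h * v r j h"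
    using smooth_eigenbasis[OF smC inj p \<sigma> C\<sigma>] by blast
  have vlim: "(v i j \<longlongrightarrow> v i j 0) (nhds 0)" and \<mu>lim: "(\<mu> j \<longlongrightarrow> \<nu> j) (nhds 0)" for i j
    using smooth_imp_continuous[OF v(1)[of i j], of 0] smooth_imp_continuous[OF \<mu>(1)[of j], of 0] \<mu>(2)[of j]
    by (simp_all add: continuous_at tendsto_nhds_iff)
  have voff: "v i j 0 = 0" if "i \<noteq> j" for i j
    by (rule bigo_value_at_0[OF smooth_imp_continuous[OF v(1)], where s = "\<lambda>_. 0" and p = p])
      (use v(3)[OF that] p in auto)
  \<comment> \<open>Normalising the diagonal to one makes \<open>U 0\<close> the identity, leaves
    only off-diagonal entries to estimate, and later lets the eigenvalues of \<open>X\<close> be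
    read off a diagonal.\<close>
  define U where "U h = (\<chi> i j. v i j h / v j j h)" for h
  have Ulim: "((\<lambda>h. U h $ i $ j) \<longlongrightarrow> (if i = j then 1 else 0)) (nhds 0)" for i j
    using tendsto_divide[OF vlim vlim v(2), of i j j] voff[of i j] v(2)[of j] by (auto simp: U_def)
  have "((\<lambda>h. det (U h)) \<longlongrightarrow> det (mat 1 :: real^'n^'n)) (nhds 0)"
    unfolding det_def by (intro tendsto_sum tendsto_mult tendsto_prod tendsto_const) (use Ulim in \<open>simp add: mat_def\<close>)
  then have "\<forall>\<^sub>F h in nhds 0. det (U h) \<noteq> 0"
    by (rule tendsto_imp_eventually_ne) simp
  moreover have "\<forall>\<^sub>F h in nhds 0. \<forall>j. v j j h \<noteq> 0"
    by (intro eventually_all_finite tendsto_imp_eventually_ne[OF vlim v(2)])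
  moreover have "\<forall>\<^sub>F h in nhds 0. \<forall>j. \<bar>h * \<mu> j h\<bar> < 1"
  proof (intro eventually_all_finite)
    fix j
    have "((\<lambda>h. \<bar>h * \<mu> j h\<bar>) \<longlongrightarrow> \<bar>0 * \<nu> j\<bar>) (nhds 0)"
      by (intro tendsto_intros \<mu>lim filterlim_ident)
    then show "\<forall>\<^sub>F h in nhds 0. \<bar>h * \<mu> j h\<bar> < 1" by (rule order_tendstoD) simp
  qed
  ultimately have "\<forall>\<^sub>F h in nhds 0. det (U h) \<noteq> 0 \<and> (\<forall>j. v j j h \<noteq> 0) \<and> (\<forall>j. \<bar>h * \<mu> j h\<bar> < 1)"
    by eventually_elim blast
  then obtain \<delta> where \<delta>: "\<delta> > 0"
    "\<And>h. \<bar>h\<bar> < \<delta> \<Longrightarrow> det (U h) \<noteq> 0 \<and> (\<forall>j. v j j h \<noteq> 0) \<and> (\<forall>j. \<bar>h * \<mu> j h\<bar> < 1)"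
    unfolding eventually_nhds_metric by (auto simp: dist_real_def)
  obtain \<phi> where \<phi>: "smooth \<phi>" "\<And>x. \<bar>\<phi> x\<bar> < \<delta>" "\<And>x. \<bar>x\<bar> \<le> \<delta> / 2 \<Longrightarrow> \<phi> x = x"
    using smooth_cutoff[OF \<delta>(1)] by blast
  have good: "det (U (\<phi> h)) \<noteq> 0" "v j j (\<phi> h) \<noteq> 0" "\<bar>\<phi> h * \<mu> j (\<phi> h)\<bar> < 1" for h j
    using \<delta>(2)[OF \<phi>(2)] by auto
  have \<phi>id: "\<forall>\<^sub>F h in nhds 0. \<phi> h = h"
  proof -
    have "\<forall>\<^sub>F h in nhds 0. \<bar>h\<bar> < \<delta> / 2"
      using \<delta>(1) by (intro order_tendstoD(2)[of abs 0] tendsto_rabs_zero filterlim_ident) simp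
    then show ?thesis by eventually_elim (use \<phi>(3) in auto)
  qed
  have nd: "ndiff n \<phi>" "ndiff n (\<lambda>h. v i j (\<phi> h))" "ndiff n (\<lambda>h. \<mu> j (\<phi> h))" for n i j
    using \<phi>(1) v(1) \<mu>(1) by (simp_all add: smooth_iff_ndiff ndiff_compose)
  define V where "V h = U (\<phi> h)" for h
  have smV: "smooth (\<lambda>h. V h $ i $ j)" for i j
    unfolding smooth_iff_ndiff V_def U_def by (simp add: ndiff_divide nd good)
  have invV: "invertible (V h)" for h
    using good by (simp add: V_def invertible_det_nz)
  have V1: "V h $ j $ j = 1" for h j
    using good by (simp add: V_def U_def)
  have \<phi>0: "\<phi> 0 = 0" using \<phi>(3)[of 0] \<delta>(1) by simp
  have bV: "(\<lambda>h. V h $ i $ j - V 0 $ i $ j) \<in> O[at 0](\<lambda>h. h ^ p)" for i j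
  proof (cases "i = j")
    case True
    then show ?thesis by (simp add: V1)
  next
    case False
    have "((\<lambda>h. inverse (v j j h)) \<longlongrightarrow> inverse (v j j 0)) (at 0)"
      using smooth_imp_continuous[OF v(1)[of j j], of 0] v(2)[of j]
      by (intro tendsto_inverse) (auto simp: isCont_def)
    from landau_o.big.mult[OF v(3)[OF False] tendsto_imp_bigo_1[OF this]]
    have "(\<lambda>h. v i j h * inverse (v j j h)) \<in> O[at 0](\<lambda>h. h ^ p)" by simp
    moreover have "\<forall>\<^sub>F h in at 0. v i j h * inverse (v j j h) = V h $ i $ j - V 0 $ i $ j"
      using eventually_at_if_nhds[OF \<phi>id]
      by eventually_elim (simp add: V_def U_def \<phi>0 voff[OF False] divide_inverse)
    ultimately show ?thesis by (subst (asm) landau_o.big.in_cong)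
  qed
  \<comment> \<open>\<open>\<theta> j h\<close> is the angle \<open>h * d j h\<close>. It is
    globally smooth because the cutoff keeps the argument of \<open>arcsin\<close> inside the open
    interval, and it vanishes at the origin, so \<open>smooth_hadamard\<close> can divide it by
    \<open>h\<close>.\<close>
  define \<theta> where "\<theta> j h = arcsin (\<phi> h * \<mu> j (\<phi> h))" for j h
  have sm\<theta>: "smooth (\<theta> j)" for j
    unfolding smooth_iff_ndiff \<theta>_def by (intro allI ndiff_arcsin ndiff_mult nd good)
  have \<theta>0: "\<theta> j 0 = 0" for j by (simp add: \<theta>_def \<phi>0)
  have "\<exists>g. smooth g \<and> (\<forall>h. \<theta> j h = h * g h)" for j
    using smooth_hadamard[OF sm\<theta> \<theta>0] by blast
  then obtain d where d: "\<And>j. smooth (d j)" "\<And>j h. \<theta> j h = h * d j h"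
    by metis
  have sin\<theta>: "sin (\<theta> j h) = \<phi> h * \<mu> j (\<phi> h)" and cos\<theta>: "cos (\<theta> j h) = sqrt (1 - (\<phi> h * \<mu> j (\<phi> h))\<^sup>2)" for j h
    using good(3)[of h j] by (simp_all add: \<theta>_def cos_arcsin abs_less_iff)
  have bd: "(\<lambda>h. d j h - \<nu> j) \<in> O[at 0](\<lambda>h. h ^ p)" for j
  proof (rule bigo_cancel_var)
    have "((\<lambda>h. \<bar>\<theta> j h\<bar>) \<longlongrightarrow> \<bar>0\<bar>) (at 0)"
      using smooth_imp_continuous[OF sm\<theta>[of j], of 0] \<theta>0[of j] by (intro tendsto_intros) (simp add: isCont_def)
    then have "\<forall>\<^sub>F h in at 0. \<bar>\<theta> j h\<bar> < 1" by (rule order_tendstoD) simp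
    moreover have "((\<lambda>h. \<bar>h * \<nu> j\<bar>) \<longlongrightarrow> \<bar>0 * \<nu> j\<bar>) (at 0)" by (intro tendsto_intros)
    then have "\<forall>\<^sub>F h in at 0. \<bar>h * \<nu> j\<bar> < 1" by (rule order_tendstoD) simp
    moreover have "\<forall>\<^sub>F h::real in at 0. h \<noteq> 0" by (simp add: eventually_at_filter)
    \<comment> \<open>Near the origin the sines of the two angles \<open>h * d j h\<close> and
      \<open>h * \<nu> j\<close> are \<open>h * \<mu> j h\<close> and
      \<open>h * \<sigma> j h\<close>.\<close>
    ultimately have "\<forall>\<^sub>F h in at 0. norm (h * (d j h - \<nu> j)) \<le> 2 * norm (h * (\<mu> j h - \<sigma> j h))"
      using eventually_at_if_nhds[OF \<phi>id]
    proof eventually_elim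
      case (elim h)
      have "\<bar>\<theta> j h - h * \<nu> j\<bar> \<le> 2 * \<bar>sin (\<theta> j h) - sin (h * \<nu> j)\<bar>"
        using elim by (intro abs_diff_le_sin) auto
      then show ?case
        using elim sin\<theta>[of j h] by (simp add: d(2) \<sigma>_def right_diff_distrib)
    qed
    then have "(\<lambda>h. h * (d j h - \<nu> j)) \<in> O[at 0](\<lambda>h. h * (\<mu> j h - \<sigma> j h))" by (rule bigoI)
    moreover have "(\<lambda>h. h * (\<mu> j h - \<sigma> j h)) \<in> O[at 0](\<lambda>h. h * h ^ p)"
      by (intro landau_o.big.mult \<mu>(3) landau_o.big_refl)
    ultimately show "(\<lambda>h. h * (d j h - \<nu> j)) \<in> O[at 0](\<lambda>h. h ^ Suc p)"
      using landau_o.big_trans by fastforce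
  qed
  have d0: "d j 0 = \<nu> j" for j
    by (rule bigo_value_at_0[OF smooth_imp_continuous[OF d(1)] bd p tendsto_const])
  have CV: "\<forall>\<^sub>F h in nhds 0. C h ** V h = V h ** diag_matrix (\<lambda>j. \<mu> j h)"
  proof -
    have "\<forall>\<^sub>F h in nhds 0. \<forall>r j. (\<Sum>i\<in>UNIV. C h $ r $ i * v i j h) = \<mu> j h * v r j h"
      by (intro eventually_all_finite ker)
    with \<phi>id show ?thesis
    proof eventually_elim
      case (elim h)
      have "(C h ** V h) $ r $ j = (V h ** diag_matrix (\<lambda>j. \<mu> j h)) $ r $ j" for r j
      proof -
        have "(C h ** V h) $ r $ j = (\<Sum>i\<in>UNIV. C h $ r $ i * v i j h) / v j j h"
          by (simp add: matrix_matrix_mult_def V_def U_def elim(1) sum_divide_distrib)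
        then show ?thesis
          using elim by (simp add: mult_diag_matrix_nth V_def U_def)
      qed
      then show ?case by (simp add: vec_eq_iff)
    qed
  qed
  have dist: "\<forall>\<^sub>F h in nhds 0. \<forall>i j. i \<noteq> j \<longrightarrow> \<mu> i h \<noteq> \<mu> j h"
  proof (intro eventually_all_finite)
    fix i j
    show "\<forall>\<^sub>F h in nhds 0. i \<noteq> j \<longrightarrow> \<mu> i h \<noteq> \<mu> j h"
    proof (cases "i = j")
      case False
      then have "\<nu> i - \<nu> j \<noteq> 0" using inj by (simp add: inj_eq)
      from tendsto_imp_eventually_ne[OF tendsto_diff[OF \<mu>lim \<mu>lim] this]
      show ?thesis by eventually_elim simp
    qed simp
  qed
  \<comment> \<open>This decides the sign of the square root: once \<open>W\<close> below is known
    to be diagonal, these entries are its eigenvalues, as \<open>V\<close> has unit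
    diagonal.\<close>
  have XVpos: "\<forall>\<^sub>F h in nhds 0. \<forall>j. (X h ** V h) $ j $ j > 0"
  proof (intro eventually_all_finite)
    fix j
    have Vlim: "((\<lambda>h. V h $ i $ j) \<longlongrightarrow> (if i = j then 1 else 0)) (nhds 0)" for i j
      using Ulim[of i j] by (rule Lim_transform_eventually) (use \<phi>id in \<open>eventually_elim, simp add: V_def\<close>)
    have Xlim: "((\<lambda>h. X h $ i $ j) \<longlongrightarrow> X 0 $ i $ j) (nhds 0)" for i j
      using smooth_imp_continuous[OF smX[of i j], of 0] by (simp add: continuous_at tendsto_nhds_iff)
    have "((\<lambda>h. (X h ** V h) $ j $ j) \<longlongrightarrow> (\<Sum>i\<in>UNIV. X 0 $ j $ i * (if i = j then 1 else 0))) (nhds 0)"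
      unfolding matrix_matrix_mult_def by simp (intro tendsto_intros Xlim Vlim)
    moreover have "(\<Sum>i\<in>UNIV. X 0 $ j $ i * (if i = j then 1 else 0)) = 1"
      by (simp add: X0 if_distrib cong: if_cong)
    ultimately show "\<forall>\<^sub>F h in nhds 0. (X h ** V h) $ j $ j > 0"
      by (intro order_tendstoD(1)) auto
  qed
  have "\<forall>\<^sub>F h in nhds 0. X h ** V h = V h ** diag_matrix (\<lambda>j. cos (h * d j h)) \<and>
      Y h ** V h = V h ** diag_matrix (\<lambda>j. sin (h * d j h))"
    using CV dist XVpos \<phi>id
  proof eventually_elim
    case (elim h)
    let ?M = "diag_matrix (\<lambda>j. \<mu> j h)"
    have VVi: "V h ** matrix_inv (V h) = mat 1" and ViV: "matrix_inv (V h) ** V h = mat 1"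
      using invV[of h] by (simp_all add: matrix_inv_inverse)
    define W where "W = matrix_inv (V h) ** (X h ** V h)"
    have VW: "V h ** W = X h ** V h"
      by (simp add: W_def matrix_mul_assoc VVi)
    have YV: "Y h ** V h = V h ** diag_matrix (\<lambda>j. h * \<mu> j h)"
    proof -
      have "Y h ** V h = h *\<^sub>R (C h ** V h)"
        by (simp add: YC scaleR_matrix_mult)
      then show ?thesis
        by (simp add: elim(1) vec_eq_iff mult_diag_matrix_nth mult_ac)
    qed
    \<comment> \<open>\<open>comm\<close> can be divided by \<open>h\<close> except at the origin,
      where \<open>X\<close> is the identity.\<close>
    have XC: "X h ** C h = C h ** X h"
    proof (cases "h = 0")
      case True
      have "X 0 = mat 1" by (simp add: vec_eq_iff X0 mat_def)
      then show ?thesis using True by simp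
    next
      case False
      have "h *\<^sub>R (X h ** C h) = h *\<^sub>R (C h ** X h)"
        using comm[of h] by (simp add: YC scaleR_matrix_mult matrix_scaleR_mult)
      then show ?thesis using False by simp
    qed
    have "V h ** (?M ** W) = C h ** (V h ** W)"
      by (simp add: matrix_mul_assoc elim(1))
    also have "\<dots> = X h ** (C h ** V h)"
      unfolding VW by (simp add: matrix_mul_assoc XC)
    also have "\<dots> = V h ** (W ** ?M)"
      unfolding elim(1) by (simp add: matrix_mul_assoc VW)
    finally have MW: "?M ** W = W ** ?M"
      by (metis ViV matrix_mul_assoc matrix_mul_lid)
    \<comment> \<open>A matrix commuting with a diagonal matrix of distinct entries is
      diagonal.\<close>
    have "W $ i $ j = 0" if "i \<noteq> j" for i j
    proof -
      have "\<mu> i h * W $ i $ j = W $ i $ j * \<mu> j h"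
        using MW by (metis diag_matrix_mult_nth mult_diag_matrix_nth)
      moreover have "\<mu> i h \<noteq> \<mu> j h" using elim(2) that by blast
      ultimately show ?thesis by (simp add: mult.commute)
    qed
    then have Wd: "W = diag_matrix (\<lambda>j. W $ j $ j)"
      by (simp add: vec_eq_iff diag_matrix_nth)
    \<comment> \<open>In the basis \<open>V\<close> the identity \<open>sq\<close> reads
      \<open>W^2 + (h * \<mu>)^2 = 1\<close>, and positivity selects the root that is the cosine of
      the angle.\<close>
    have Wj: "W $ j $ j = cos (h * d j h)" for j
    proof -
      have "(X h ** X h + Y h ** Y h) ** V h =
          V h ** (W ** W) + V h ** (diag_matrix (\<lambda>j. h * \<mu> j h) ** diag_matrix (\<lambda>j. h * \<mu> j h))"
      proof -
        have "X h ** X h ** V h = V h ** (W ** W)"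
          by (metis VW matrix_mul_assoc)
        moreover have "Y h ** Y h ** V h = V h ** (diag_matrix (\<lambda>j. h * \<mu> j h) ** diag_matrix (\<lambda>j. h * \<mu> j h))"
          by (metis YV matrix_mul_assoc)
        ultimately show ?thesis by (simp add: matrix_add_rdistrib)
      qed
      then have "V h ** (W ** W + diag_matrix (\<lambda>j. h * \<mu> j h) ** diag_matrix (\<lambda>j. h * \<mu> j h)) = V h"
        by (simp add: sq matrix_add_ldistrib)
      then have "W ** W + diag_matrix (\<lambda>j. h * \<mu> j h) ** diag_matrix (\<lambda>j. h * \<mu> j h) = mat 1"
        by (metis ViV matrix_mul_assoc matrix_mul_lid)
      from arg_cong[OF this, of "\<lambda>A. A $ j $ j"]
      have "(W ** W) $ j $ j + (h * \<mu> j h) * (h * \<mu> j h) = 1"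
        by (simp add: diag_matrix_mult diag_matrix_nth mat_def)
      moreover have "(W ** W) $ j $ j = W $ j $ j * W $ j $ j"
        by (subst Wd) (rule diag_matrix_mult_nth)
      ultimately have sq1: "(W $ j $ j)\<^sup>2 = 1 - (h * \<mu> j h)\<^sup>2"
        by (simp add: power2_eq_square)
      have "(V h ** W) $ j $ j = W $ j $ j"
        by (subst Wd) (simp add: mult_diag_matrix_nth V1)
      then have "W $ j $ j > 0" using elim(3)[rule_format, of j] by (simp add: VW)
      then have "sqrt (1 - (h * \<mu> j h)\<^sup>2) = W $ j $ j"
        using sq1 by (intro real_sqrt_unique) auto
      then show ?thesis using cos\<theta>[of j h] by (simp add: elim(4) d(2))
    qed
    have "X h ** V h = V h ** diag_matrix (\<lambda>j. cos (h * d j h))"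
      using VW Wd by (simp add: Wj)
    moreover have "diag_matrix (\<lambda>j. h * \<mu> j h) = diag_matrix (\<lambda>j. sin (h * d j h))"
      using sin\<theta>[of _ h] by (simp add: elim(4) d(2))
    ultimately show ?case using YV by simp
  qed
  from that[OF smV d(1) invV bV _ this] show ?thesis
    using bd by (simp add: d0)
qed

section \<open>The factorisation of a reversible family\<close>

text \<open>A vector is a finite sum of bounded linear images of its components. The component type
  is itself a Euclidean space, so applying the rule twice covers matrices.\<close>

lemma ndiff_vec:
  fixes f :: "real \<Rightarrow> 'b::euclidean_space^'m"
  assumes "\<And>i. ndiff n (\<lambda>h. f h $ i)"
  shows "ndiff n f"
proof -
  have eq: "f = (\<lambda>h. \<Sum>i\<in>UNIV. axis i (f h $ i))"
  proof (rule ext)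
    fix h
    have "(\<Sum>i\<in>UNIV. axis i (f h $ i)) $ r = (\<Sum>i\<in>UNIV. if r = i then f h $ i else 0)" for r
      unfolding sum_component axis_def by (intro sum.cong refl) simp
    also have "\<dots> r = f h $ r" for r
      by (simp only: sum.delta' finite UNIV_I if_True)
    finally show "f h = (\<Sum>i\<in>UNIV. axis i (f h $ i))"
      unfolding vec_eq_iff by metis
  qed
  have "bounded_linear (axis i :: 'b \<Rightarrow> 'b^'m)" for i
    by (rule linear_conv_bounded_linear[THEN iffD1, OF linearI]) (simp_all add: vec_eq_iff axis_def)
  from ndiff_sum[OF ndiff_bounded_linear[OF this assms]]
  have "ndiff n (\<lambda>h. \<Sum>i\<in>UNIV. axis i (f h $ i))" .
  then show ?thesis by (subst eq)
qed

lemma smooth_matrixI: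
  fixes A :: "real \<Rightarrow> real^'n^'m"
  assumes "\<And>i j. smooth (\<lambda>h. A h $ i $ j)"
  shows "smooth A"
proof -
  have "ndiff n (\<lambda>h. A h $ i $ j)" for n i j
    using assms[of i j] unfolding smooth_iff_ndiff ..
  then have "ndiff n A" for n
    by (rule ndiff_vec[OF ndiff_vec])
  then show ?thesis unfolding smooth_iff_ndiff ..
qed

lemma norm_matrix_bigo:
  fixes A :: "real \<Rightarrow> real^'n^'m"
  assumes "\<And>i j. (\<lambda>h. A h $ i $ j) \<in> O[F](g)"
  shows "(\<lambda>h. norm (A h)) \<in> O[F](g)"
proof -
  have "norm (A h) \<le> (\<Sum>i\<in>UNIV. \<Sum>j\<in>UNIV. \<bar>A h $ i $ j\<bar>)" for h
    unfolding norm_vec_def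
    by (intro order_trans[OF L2_set_le_sum] sum_mono) (simp_all add: norm_vec_def L2_set_le_sum)
  then have "(\<lambda>h. norm (A h)) \<in> O[F](\<lambda>h. \<Sum>i\<in>UNIV. \<Sum>j\<in>UNIV. \<bar>A h $ i $ j\<bar>)"
    by (intro bigoI[of _ 1] always_eventually) (simp add: sum_nonneg)
  moreover have "(\<lambda>h. \<Sum>i\<in>UNIV. \<Sum>j\<in>UNIV. \<bar>A h $ i $ j\<bar>) \<in> O[F](g)"
    using assms by (intro big_sum_in_bigo) simp
  ultimately show ?thesis by (rule landau_o.big_trans)
qed

lemma matrix_cnj_nth: "matrix_cnj A $ i $ j = cnj (A $ i $ j)"
  by (simp add: matrix_cnj_def map_matrix_def)

lemma matrix_cnj_mult: "matrix_cnj (A ** B) = matrix_cnj A ** matrix_cnj B"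
  by (simp add: vec_eq_iff matrix_cnj_nth matrix_matrix_mult_def)

lemma matrix_cnj_complexify: "matrix_cnj (complexify A) = complexify A"
  by (simp add: vec_eq_iff matrix_cnj_nth complexify_nth)

text \<open>Changing the basis and reading off an entry is a single bounded linear map, which
  transfers both smoothness and error bounds from \<open>S\<close> to \<open>X\<close> and
  \<open>Y\<close>.\<close>

lemma bounded_linear_conj_entry:
  fixes A B :: "complex^'n^'n"
  shows "bounded_linear (\<lambda>M. (A ** M ** B) $ i $ j)"
  unfolding linear_conv_bounded_linear[symmetric]
  by (rule linearI)
    (simp_all add: matrix_add_ldistrib matrix_add_rdistrib matrix_scaleR_mult scaleR_matrix_mult)

lemma bigo_bounded_linear:
  assumes "bounded_linear L" "(\<lambda>h. norm (f h)) \<in> O[F](g)"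
  shows "(\<lambda>h. L (f h)) \<in> O[F](g)"
proof -
  obtain K where K: "\<And>x. norm (L x) \<le> norm x * K"
    using bounded_linear.bounded[OF assms(1)] by blast
  have "(\<lambda>h. L (f h)) \<in> O[F](\<lambda>h. norm (f h))"
    using K by (intro bigoI[of _ K] always_eventually) (simp add: mult.commute)
  then show ?thesis using assms(2) by (rule landau_o.big_trans)
qed

theorem theorem3p1:
  fixes H :: "real^'n^'n"
    and S :: "real \<Rightarrow> complex^'n^'n"
    and p :: nat
  assumes smooth_S: "smooth S"
    and rev: "\<And>h. reversible (S h)"
    and p_pos: "p \<ge> 1"
    and consistent:
      "(\<lambda>h. norm (S h - matrix_exp (matrix_scale (\<i> * of_real h) (complexify H))))
         \<in> O[at 0](\<lambda>h. h ^ (p + 1))"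
    and eig: "\<And>c. eigenvalue (complexify H) c \<Longrightarrow>
                c \<in> \<real> \<and> simple_eigenvalue (complexify H) c"
  shows "\<exists>(D :: real \<Rightarrow> real^'n^'n) (P :: real \<Rightarrow> real^'n^'n).
           smooth D \<and> (\<forall>h. is_diagonal (D h)) \<and>
           smooth P \<and> (\<forall>h. invertible (P h)) \<and>
           (\<lambda>h. norm (P h - P 0)) \<in> O[at 0](\<lambda>h. h ^ p) \<and>
           (\<lambda>h. norm (D h - D 0)) \<in> O[at 0](\<lambda>h. h ^ p) \<and>
           (\<exists>\<delta>>0. \<forall>h. \<bar>h\<bar> < \<delta> \<longrightarrow>
              S h = complexify (P h)
                    ** matrix_exp (matrix_scale (\<i> * of_real h) (complexify (D h)))
                    ** matrix_inv (complexify (P h)))"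
proof -
  obtain \<nu> :: "'n \<Rightarrow> real" where \<nu>: "inj \<nu>" "\<And>j. det (mat (\<nu> j) - H) = 0"
    using real_simple_spectrum[OF eig] by blast
  obtain Q where Q: "invertible Q" "H ** Q = Q ** diag_matrix \<nu>"
    using diagonalizable[OF \<nu>] by blast
  define A where "A = complexify Q"
  define B where "B = complexify (matrix_inv Q)"
  have AB: "A ** B = mat 1" and BA: "B ** A = mat 1"
    using matrix_inv_inverse[OF Q(1)]
    by (simp_all add: A_def B_def complexify_mult[symmetric] complexify_mat)
  have scale_diag: "matrix_scale c (A' ** diag_matrix w ** B') = A' ** diag_matrix (\<lambda>i. c * w i) ** B'"
    for c and w and A' B' :: "complex^'n^'n"
    unfolding matrix_matrix_mult_def[of "A' ** _"]
    by (simp add: vec_eq_iff matrix_scale_def map_matrix_def mult_diag_matrix_nth sum_distrib_left mult_ac)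
  have "H = Q ** diag_matrix \<nu> ** matrix_inv Q"
    unfolding Q(2)[symmetric] by (simp add: matrix_mul_assoc[symmetric] matrix_inv_inverse[OF Q(1)])
  then have cH: "complexify H = A ** diag_matrix (\<lambda>i. of_real (\<nu> i)) ** B"
    by (simp add: A_def B_def complexify_mult complexify_diag_matrix)
  define E where "E h = S h - matrix_exp (matrix_scale (\<i> * of_real h) (complexify H))" for h
  \<comment> \<open>The basis that diagonalises \<open>H\<close> also diagonalises its exponential,
    so the consistency error compares \<open>W\<close> with an explicit diagonal matrix.\<close>
  have BEA: "B ** E h ** A = B ** S h ** A - diag_matrix (\<lambda>i. exp (\<i> * of_real h * of_real (\<nu> i)))" for h
  proof -
    have "B ** matrix_exp (matrix_scale (\<i> * of_real h) (complexify H)) ** A =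
        (B ** A) ** diag_matrix (\<lambda>i. exp (\<i> * of_real h * of_real (\<nu> i))) ** (B ** A)"
      unfolding cH scale_diag matrix_exp_conj_diag[OF BA AB] by (simp only: matrix_mul_assoc)
    then show ?thesis
      using linear_diff[OF bounded_linear.linear[OF bounded_linear_conj_entry[of B A]]]
      by (simp add: E_def BA vec_eq_iff)
  qed
  define W where "W h = B ** S h ** A" for h
  define X where "X h = (\<chi> i j. Re (W h $ i $ j))" for h
  define Y where "Y h = (\<chi> i j. Im (W h $ i $ j))" for h
  have XY: "W h $ i $ j = of_real (X h $ i $ j) + \<i> * of_real (Y h $ i $ j)" for h i j
    by (simp add: X_def Y_def complex_eq)
  have ndS: "ndiff n S" for n using smooth_S unfolding smooth_iff_ndiff ..
  have smX: "smooth (\<lambda>h. X h $ i $ j)" and smY: "smooth (\<lambda>h. Y h $ i $ j)" for i j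
    unfolding smooth_iff_ndiff X_def Y_def W_def
    using ndiff_bounded_linear[OF bounded_linear_compose[OF bounded_linear_Re bounded_linear_conj_entry] ndS]
      ndiff_bounded_linear[OF bounded_linear_compose[OF bounded_linear_Im bounded_linear_conj_entry] ndS]
    by simp_all
  \<comment> \<open>\<open>A\<close> and \<open>B\<close> are real, so conjugation acts on
    \<open>S h\<close> alone and turns it into its inverse.\<close>
  have "matrix_cnj (W h) ** W h = mat 1" for h
  proof -
    have "matrix_cnj (W h) ** W h = B ** matrix_inv (S h) ** (A ** B) ** S h ** A"
      using rev[of h] unfolding reversible_def W_def
      by (simp add: matrix_cnj_mult A_def B_def matrix_cnj_complexify matrix_mul_assoc)
    also have "\<dots> = B ** (matrix_inv (S h) ** S h) ** A"
      by (simp add: AB matrix_mul_assoc)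
    also have "\<dots> = mat 1"
      using rev[of h] unfolding reversible_def by (simp add: matrix_inv_inverse BA)
    finally show ?thesis .
  qed
  then have WW: "(\<Sum>k\<in>UNIV. cnj (W h $ i $ k) * W h $ k $ j) = (if i = j then 1 else 0)" for h i j
    by (simp add: vec_eq_iff matrix_matrix_mult_def matrix_cnj_nth mat_def)
  \<comment> \<open>The real part of \<open>(X - \<i> Y) (X + \<i> Y) = 1\<close>; the imaginary
    part gives \<open>comm\<close>.\<close>
  have sq: "X h ** X h + Y h ** Y h = mat 1" for h
  proof -
    have "(X h ** X h + Y h ** Y h) $ i $ j = (mat 1 :: real^'n^'n) $ i $ j" for i j
      using arg_cong[OF WW[of h i j], of Re]
      by (simp add: XY matrix_matrix_mult_def mat_def sum.distrib split: if_splits)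
    then show ?thesis by (simp add: vec_eq_iff)
  qed
  have comm: "X h ** Y h = Y h ** X h" for h
  proof -
    have "(X h ** Y h) $ i $ j = (Y h ** X h) $ i $ j" for i j
      using arg_cong[OF WW[of h i j], of Im]
      by (simp add: XY matrix_matrix_mult_def sum_subtractf split: if_splits)
    then show ?thesis by (simp add: vec_eq_iff)
  qed
  have bE: "(\<lambda>h. L (E h)) \<in> O[at 0](\<lambda>h. h ^ Suc p)" if "bounded_linear L" for L :: "complex^'n^'n \<Rightarrow> real"
    by (rule bigo_bounded_linear[OF that]) (use consistent in \<open>simp add: E_def\<close>)
  have bX: "(\<lambda>h. X h $ i $ j - (if i = j then cos (h * \<nu> i) else 0)) \<in> O[at 0](\<lambda>h. h ^ Suc p)" for i j
  proof -
    have "Re ((B ** E h ** A) $ i $ j) = X h $ i $ j - (if i = j then cos (h * \<nu> i) else 0)" for h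
      by (simp add: BEA X_def W_def diag_matrix_nth Re_exp)
    then show ?thesis
      using bE[OF bounded_linear_compose[OF bounded_linear_Re bounded_linear_conj_entry[of B A i j]]] by simp
  qed
  have bY: "(\<lambda>h. Y h $ i $ j - (if i = j then sin (h * \<nu> i) else 0)) \<in> O[at 0](\<lambda>h. h ^ Suc p)" for i j
  proof -
    have "Im ((B ** E h ** A) $ i $ j) = Y h $ i $ j - (if i = j then sin (h * \<nu> i) else 0)" for h
      by (simp add: BEA Y_def W_def diag_matrix_nth Im_exp)
    then show ?thesis
      using bE[OF bounded_linear_compose[OF bounded_linear_Im bounded_linear_conj_entry[of B A i j]]] by simp
  qed
  obtain V :: "real \<Rightarrow> real^'n^'n" and d where V: "\<And>i j. smooth (\<lambda>h. V h $ i $ j)" "\<And>h. invertible (V h)"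
      "\<And>i j. (\<lambda>h. V h $ i $ j - V 0 $ i $ j) \<in> O[at 0](\<lambda>h. h ^ p)"
    and d: "\<And>j. smooth (d j)" "\<And>j. (\<lambda>h. d j h - d j 0) \<in> O[at 0](\<lambda>h. h ^ p)"
    and eq: "\<forall>\<^sub>F h in nhds 0. X h ** V h = V h ** diag_matrix (\<lambda>j. cos (h * d j h)) \<and>
       Y h ** V h = V h ** diag_matrix (\<lambda>j. sin (h * d j h))"
    by (rule simultaneous_diagonalization[OF smX smY sq comm \<nu>(1) p_pos bX bY]) (rule that)
  \<comment> \<open>First the \<open>h\<close>-dependent eigenbasis in the coordinates of
    \<open>Q\<close>, then the fixed change back from the eigenbasis of \<open>H\<close>.\<close>
  define P where "P h = Q ** V h" for h
  define D where "D h = diag_matrix (\<lambda>j. d j h)" for h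
  have Pnth: "P h $ i $ j = (\<Sum>k\<in>UNIV. Q $ i $ k * V h $ k $ j)" for h i j
    by (simp add: P_def matrix_matrix_mult_def)
  have "smooth P"
  proof (rule smooth_matrixI)
    fix i j
    have "ndiff n (\<lambda>h. V h $ k $ j)" for n k using V(1)[of k j] unfolding smooth_iff_ndiff ..
    then show "smooth (\<lambda>h. P h $ i $ j)"
      unfolding Pnth smooth_iff_ndiff by (intro allI ndiff_sum ndiff_mult ndiff_const)
  qed
  moreover have "smooth D"
  proof (rule smooth_matrixI)
    fix i j
    show "smooth (\<lambda>h. D h $ i $ j)"
      using d(1) by (cases "i = j") (simp_all add: D_def diag_matrix_nth smooth_iff_ndiff ndiff_const)
  qed
  moreover have "is_diagonal (D h)" for h
    by (simp add: D_def is_diagonal_diag_matrix)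
  moreover have invP: "invertible (P h)" for h
    unfolding P_def by (rule invertible_mult[OF Q(1) V(2)])
  moreover have "(\<lambda>h. norm (P h - P 0)) \<in> O[at 0](\<lambda>h. h ^ p)"
  proof (rule norm_matrix_bigo)
    fix i j
    have "(\<lambda>h. \<Sum>k\<in>UNIV. Q $ i $ k * (V h $ k $ j - V 0 $ k $ j)) \<in> O[at 0](\<lambda>h. h ^ p)"
      using V(3) by (intro big_sum_in_bigo) simp
    then show "(\<lambda>h. (P h - P 0) $ i $ j) \<in> O[at 0](\<lambda>h. h ^ p)"
      by (simp add: Pnth sum_subtractf right_diff_distrib)
  qed
  moreover have "(\<lambda>h. norm (D h - D 0)) \<in> O[at 0](\<lambda>h. h ^ p)"
  proof (rule norm_matrix_bigo)
    fix i j
    show "(\<lambda>h. (D h - D 0) $ i $ j) \<in> O[at 0](\<lambda>h. h ^ p)"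
      using d(2) by (cases "i = j") (simp_all add: D_def diag_matrix_nth)
  qed
  moreover have "\<forall>\<^sub>F h in nhds 0. S h = complexify (P h)
      ** matrix_exp (matrix_scale (\<i> * of_real h) (complexify (D h))) ** matrix_inv (complexify (P h))"
    using eq
  proof eventually_elim
    case (elim h)
    let ?e = "diag_matrix (\<lambda>j. exp (\<i> * of_real h * of_real (d j h)))"
    \<comment> \<open>The rules for conjugated diagonal matrices are used with trivial conjugation
      by the identity.\<close>
    have exp: "matrix_exp (matrix_scale (\<i> * of_real h) (complexify (D h))) = ?e"
      using scale_diag[of "\<i> * of_real h" "mat 1" "\<lambda>j. of_real (d j h)" "mat 1"]
        matrix_exp_conj_diag[of "mat 1" "mat 1" "\<lambda>j. \<i> * of_real h * of_real (d j h)"]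
      by (simp add: D_def complexify_diag_matrix)
    \<comment> \<open>\<open>X\<close> and \<open>Y\<close> act on the columns of \<open>V\<close>
      by cosines and sines of the same angles, so Euler's formula gives the exponential for
      \<open>X + \<i> Y\<close>.\<close>
    have "(W h ** complexify (V h)) $ i $ j = (complexify (V h) ** ?e) $ i $ j" for i j
    proof -
      have "(W h ** complexify (V h)) $ i $ j =
          of_real ((X h ** V h) $ i $ j) + \<i> * of_real ((Y h ** V h) $ i $ j)"
        by (simp add: matrix_matrix_mult_def XY complexify_nth sum_distrib_left sum.distrib[symmetric] algebra_simps)
      also have "\<dots> = of_real (V h $ i $ j) * (cos (of_real (h * d j h)) + \<i> * sin (of_real (h * d j h)))"
        using elim by (simp add: mult_diag_matrix_nth cos_of_real[symmetric] sin_of_real[symmetric] algebra_simps)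
      also have "\<dots> = of_real (V h $ i $ j) * exp (\<i> * of_real (h * d j h))"
        by (simp only: exp_Euler)
      finally show ?thesis
        by (simp add: mult_diag_matrix_nth complexify_nth mult.assoc)
    qed
    then have WV: "W h ** complexify (V h) = complexify (V h) ** ?e"
      by (simp add: vec_eq_iff)
    have SA: "S h ** A = A ** W h"
      unfolding W_def by (simp add: matrix_mul_assoc AB)
    have "S h ** complexify (P h) = A ** (W h ** complexify (V h))"
      unfolding P_def complexify_mult A_def[symmetric] by (simp add: matrix_mul_assoc SA)
    also have "\<dots> = complexify (P h) ** ?e"
      unfolding WV P_def complexify_mult A_def[symmetric] by (simp add: matrix_mul_assoc)
    finally have SP: "S h ** complexify (P h) = complexify (P h) ** ?e" .
    have "complexify (P h) ** complexify (matrix_inv (P h)) = mat 1"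
      "complexify (matrix_inv (P h)) ** complexify (P h) = mat 1"
      using matrix_inv_inverse[OF invP[of h]] by (simp_all add: complexify_mult[symmetric] complexify_mat)
    then have "invertible (complexify (P h))" unfolding invertible_def by blast
    from matrix_inv_inverse(1)[OF this]
    have "S h = S h ** complexify (P h) ** matrix_inv (complexify (P h))"
      by (simp add: matrix_mul_assoc[symmetric])
    then show ?case unfolding SP exp .
  qed
  then have "\<exists>\<delta>>0. \<forall>h. \<bar>h\<bar> < \<delta> \<longrightarrow> S h = complexify (P h)
      ** matrix_exp (matrix_scale (\<i> * of_real h) (complexify (D h))) ** matrix_inv (complexify (P h))"
    unfolding eventually_nhds_metric by (simp add: dist_real_def)
  ultimately show ?thesis by blast
qed

end
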